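(* Let $X$ be a Banach space, $K\subset X$ a nonempty compact subset, $F:K\to K$ a homeomorphism, and $\mathcal{T}:K\to L(X)$, $x\mapsto T_x$, a continuous map such that $T_x$ is a compact operator for every $x\in K$. Let $N\ge 1$ be an integer, $I=\{0,1,\dots,N\}$, let $0<k_0<k_1<\cdots<k_N$ be integers, and put $j_0=k_0$, $j_{i+1}=k_{i+1}-k_i$ for $i\in I\setminus\{N\}$. Let $\{C_i\}_{i\in I}$ be a set of cones in $X$ such that $C_i$ is a complemented and $k_i$-solid cone and $T_x(C_i\setminus\{0\})\subset\mathrm{Int}\,C_i$ for all $(x,i)\in K\times I$. Let the $j_i$-dimensional continuous bundles $K\times(P_{i,x})$ ($i\in I$) and the $k_N$-codimensional continuous bundle $K\times(Q_x)$ form a decomposition of quasi-all invariant bundles for $(F,\mathcal{T})$ with index set $J=\{j_i:i\in I\}$, i.e. $X=P_{0,x}\oplus\cdots\oplus P_{N,x}\oplus Q_x$, $T_xP_{i,x}=P_{i,F(x)}$ and $T_xQ_x\subset Q_{F(x)}$ for all $x\in K$, $i\in I$, such that moreover $P_{0,x}\setminus\{0\}\subset\mathrm{Int}\,C_0$, $P_{i+1,x}\setminus\{0\}\subset\mathrm{Int}\,C_{i+1}\setminus C_i$ for $i\in I\setminus\{N\}$, and $Q_x\setminus\{0\}\subset X\setminus C_N$, for all $x\in K$. Then: (i) There exist $\gamma_i\in(0,1)$, $i\in I\setminus\{N\}$, with $c_{\mathcal{T},ix}+\log(\gamma_i)\ge c_{\mathcal{T},i+1\,x}$ for all $x\in K$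 and $i\in I\setminus\{N\}$, such that $c_{\mathcal{T},Nx}\ge\lambda_{\mathcal{T},k_Nx}$ and $c_{\mathcal{T},ix}\ge\lambda_{\mathcal{T},k_ix}\ge c_{\mathcal{T},i+1\,x}-\log(\gamma_i)$ for any $x\in K$ and $i\in I\setminus\{N\}$. (ii) For any $x\in K$ and $v\in X\setminus Q_x$, if $i\in I$ is the smallest index such that $\Pi^{P_{i,x}}_{Q_{P_i^-}}v\ne0$, then $\lambda_{\mathcal{T},x}(v)=\lambda_{\mathcal{T},x}\big(\Pi^{P_{i,x}}_{Q_{P_i^-}}v\big)$.
   Context: $L(X)$ is the space of bounded linear operators on $X$ with the operator norm; $X^*$ is the dual of $X$; $S=\{v\in X:\|v\|=1\}$. Cones. A closed subset $C\subset X$ is a cone of rank $k$ ($k$-cone) if $\mathbb{R}\cdot C\subset C$ and $\max\{\dim H: H\subset C \text{ a linear subspace}\}=k$. A $k$-cone $C$ is $k$-solid if there is a $k$-dimensional subspace $H$ with $H\setminus\{0\}\subset \mathrm{Int}\,C$; it is complemented if there is a closed $k$-codimensional linear subspace $H^c$ with $H^c\setminus\{0\}\subset X\setminus C$. Bundles. $G(k,X)$ is the set of $k$-dimensional linear subspaces of $X$, with the gap metric $d(L_1,L_2)=\max\{\sup_{v\in L_1\cap S}\inf_{u\in L_2\cap S}\|v-u\|,\ \sup_{v\in L_2\cap S}\inf_{u\in L_1\cap S}\|v-u\|\}$ (similarly $G(k,X^* )$). For a family $\{P_x\}_{x\in K}$ of $k$-dimensional subspaces of $X$, $K\times(P_x)$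 is a $k$-dimensional continuous bundle if $x\mapsto P_x\in G(k,X)$ is continuous. For a family $\{Q_x\}_{x\in K}$ of closed $k$-codimensional subspaces, $K\times(Q_x)$ is a $k$-codimensional continuous bundle if there is a $k$-dimensional continuous bundle $K\times(L_x)\subset K\times X^*$ with $\mathrm{Ker}(L_x)=\{v\in X:\ell(v)=0\ \forall \ell\in L_x\}=Q_x$ for each $x\in K$. Cocycle. The linear cocycle $(F,\mathcal{T})$ on $K\times X$ is the map $(x,v)\mapsto(F(x),T_xv)$. Write $T_x^0=\mathrm{Id}$ and $T_x^n=T_{F^{n-1}(x)}\circ T_x^{n-1}$ for $n\ge1$. Derived subspaces and projections. $SP_{i,x}=P_{0,x}\oplus\cdots\oplus P_{i,x}$ for $i\in I$; $Q_{N,x}=Q_x$ and $Q_{i,x}=P_{i+1,x}\oplus\cdots\oplus P_{N,x}\oplus Q_x$ for $i\in I\setminus\{N\}$; $Q_{P_{0,x}^-}=Q_{0,x}$ and $Q_{P_{i,x}^-}=SP_{i-1,x}\oplus Q_{i,x}$ for $i\in I\setminus\{0\}$. $\Pi^{P_{i,x}}_{Q_{P_i^-}}$ is the linear projection of $X$ onto $P_{i,x}$ along $Q_{P_{i,x}^-}$. Exponents (values in $[-\infty,+\infty)$, with $\log 0=-\infty$). For a subspace $P$ put $m(T_x^n|_P)=\inf_{v\in P\cap S}\|T_x^nv\|$. Then $c_{\mathcal{T},ix}=\limsup_{n\to+\infty}\frac1n\log m(T_x^n|_{P_{i,x}})$ is the $j_i$-characteristic exponent; $\lambda_{\mathcal{T},k_ix}=\limsup_{n\to+\infty}\frac1n\log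 m(T_x^n|_{SP_{i,x}})$ is the $k_i$-Lyapunov exponent on $K\times(SP_{i,x})$; and for $v\in X\setminus\{0\}$, $\lambda_{\mathcal{T},x}(v)=\limsup_{n\to+\infty}\frac1n\log\|T_x^nv\|$. *)

theory Defs
  imports "HOL-Analysis.Analysis" "HOL-Library.Set_Algebras"
begin

(* X is the type 'a, the dual X* is 'a \<Rightarrow>\<^sub>L real. Sums of subspaces are Minkowski sums
   of sets (HOL-Library.Set_Algebras); directness of a sum is stated separately. *)

definition compact_operator :: "('a::real_normed_vector \<Rightarrow>\<^sub>L 'b::real_normed_vector) \<Rightarrow> bool" where
  "compact_operator A \<longleftrightarrow> compact (closure (blinfun_apply A ` cball 0 1))"

definition finite_dim :: "'a::real_vector set \<Rightarrow> bool" where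
  "finite_dim H \<longleftrightarrow> subspace H \<and> (\<exists>B. finite B \<and> span B = H)"

(* The library constant dim is 0 on infinite-dimensional spaces, hence the extra condition. *)
definition G :: "nat \<Rightarrow> 'a::real_vector set set" where
  "G k = {H. finite_dim H \<and> dim H = k}"

definition closed_codim :: "nat \<Rightarrow> 'a::real_normed_vector set \<Rightarrow> bool" where
  "closed_codim k H \<longleftrightarrow>
     closed H \<and> subspace H \<and> (\<exists>L \<in> G k. H \<inter> L = {0} \<and> H + L = UNIV)"

definition k_cone :: "nat \<Rightarrow> 'a::real_normed_vector set \<Rightarrow> bool" where
  "k_cone k C \<longleftrightarrow>
     closed C \<and> (\<forall>r::real. \<forall>v\<in>C. r *\<^sub>R v \<in> C) \<and>
     (\<exists>H \<in> G k. H \<subseteq> C) \<and>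
     (\<forall>H. subspace H \<and> H \<subseteq> C \<longrightarrow> finite_dim H \<and> dim H \<le> k)"

definition k_solid :: "nat \<Rightarrow> 'a::real_normed_vector set \<Rightarrow> bool" where
  "k_solid k C \<longleftrightarrow> k_cone k C \<and> (\<exists>H \<in> G k. H - {0} \<subseteq> interior C)"

definition k_complemented :: "nat \<Rightarrow> 'a::real_normed_vector set \<Rightarrow> bool" where
  "k_complemented k C \<longleftrightarrow> k_cone k C \<and> (\<exists>Hc. closed_codim k Hc \<and> Hc - {0} \<subseteq> - C)"

(* Only meaningful for nonzero subspaces: otherwise the unit spheres are empty. *)
definition gap :: "'a::real_normed_vector set \<Rightarrow> 'a set \<Rightarrow> real" where
  "gap L1 L2 = max
     (SUP v\<in>L1 \<inter> sphere 0 1. INF u\<in>L2 \<inter> sphere 0 1. norm (v - u))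
     (SUP v\<in>L2 \<inter> sphere 0 1. INF u\<in>L1 \<inter> sphere 0 1. norm (v - u))"

definition dim_bundle ::
    "'x::topological_space set \<Rightarrow> nat \<Rightarrow> ('x \<Rightarrow> 'a::real_normed_vector set) \<Rightarrow> bool" where
  "dim_bundle K k P \<longleftrightarrow>
     (\<forall>x\<in>K. P x \<in> G k) \<and>
     (\<forall>x\<in>K. ((\<lambda>y. gap (P y) (P x)) \<longlongrightarrow> 0) (at x within K))"

definition Ker :: "('a::real_normed_vector \<Rightarrow>\<^sub>L real) set \<Rightarrow> 'a set" where
  "Ker L = {v. \<forall>l\<in>L. blinfun_apply l v = 0}"

definition codim_bundle ::
    "'x::topological_space set \<Rightarrow> nat \<Rightarrow> ('x \<Rightarrow> 'a::real_normed_vector set) \<Rightarrow> bool" where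
  "codim_bundle K k Q \<longleftrightarrow>
     (\<forall>x\<in>K. closed_codim k (Q x)) \<and>
     (\<exists>L :: 'x \<Rightarrow> ('a \<Rightarrow>\<^sub>L real) set. dim_bundle K k L \<and> (\<forall>x\<in>K. Ker (L x) = Q x))"

primrec cocycle ::
    "('x \<Rightarrow> 'x) \<Rightarrow> ('x \<Rightarrow> 'a::real_normed_vector \<Rightarrow>\<^sub>L 'a) \<Rightarrow> nat \<Rightarrow> 'x \<Rightarrow> 'a \<Rightarrow>\<^sub>L 'a" where
  "cocycle F T 0 x = id_blinfun"
| "cocycle F T (Suc n) x = T ((F ^^ n) x) o\<^sub>L cocycle F T n x"

(* The whole space is P 0 \<oplus> ... \<oplus> P N \<oplus> Q. *)
definition decomposes :: "nat \<Rightarrow> (nat \<Rightarrow> 'a::real_vector set) \<Rightarrow> 'a set \<Rightarrow> bool" where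
  "decomposes N P Q \<longleftrightarrow>
     (\<Sum>i\<le>N. P i) + Q = UNIV \<and>
     (\<forall>p q. (\<forall>i\<le>N. p i \<in> P i) \<and> q \<in> Q \<and> (\<Sum>i\<le>N. p i) + q = 0 \<longrightarrow>
        (\<forall>i\<le>N. p i = 0) \<and> q = 0)"

definition invariant_decomposition ::
    "'x set \<Rightarrow> ('x \<Rightarrow> 'x) \<Rightarrow> ('x \<Rightarrow> 'a::real_normed_vector \<Rightarrow>\<^sub>L 'a) \<Rightarrow> nat \<Rightarrow>
     (nat \<Rightarrow> 'x \<Rightarrow> 'a set) \<Rightarrow> ('x \<Rightarrow> 'a set) \<Rightarrow> bool" where
  "invariant_decomposition K F T N P Q \<longleftrightarrow>
     (\<forall>x\<in>K. decomposes N (\<lambda>i. P i x) (Q x) \<and>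
        (\<forall>i\<le>N. blinfun_apply (T x) ` P i x = P i (F x)) \<and>
        blinfun_apply (T x) ` Q x \<subseteq> Q (F x))"

definition j_of :: "(nat \<Rightarrow> nat) \<Rightarrow> nat \<Rightarrow> nat" where
  "j_of k i = (case i of 0 \<Rightarrow> k 0 | Suc m \<Rightarrow> k (Suc m) - k m)"

definition SP :: "(nat \<Rightarrow> 'x \<Rightarrow> 'a::real_vector set) \<Rightarrow> nat \<Rightarrow> 'x \<Rightarrow> 'a set" where
  "SP P i x = (\<Sum>l\<le>i. P l x)"

(* For i = N the empty sum of sets is {0}, so this is Q x. *)
definition Q_tail ::
    "nat \<Rightarrow> (nat \<Rightarrow> 'x \<Rightarrow> 'a::real_vector set) \<Rightarrow> ('x \<Rightarrow> 'a set) \<Rightarrow> nat \<Rightarrow> 'x \<Rightarrow> 'a set" where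
  "Q_tail N P Q i x = (\<Sum>l\<in>{i<..N}. P l x) + Q x"

definition Q_minus ::
    "nat \<Rightarrow> (nat \<Rightarrow> 'x \<Rightarrow> 'a::real_vector set) \<Rightarrow> ('x \<Rightarrow> 'a set) \<Rightarrow> nat \<Rightarrow> 'x \<Rightarrow> 'a set" where
  "Q_minus N P Q i x =
     (case i of 0 \<Rightarrow> Q_tail N P Q 0 x | Suc m \<Rightarrow> SP P m x + Q_tail N P Q i x)"

(* Projection onto V along W; well defined when the space is V \<oplus> W. *)
definition proj_along :: "'a::real_vector set \<Rightarrow> 'a set \<Rightarrow> 'a \<Rightarrow> 'a" where
  "proj_along V W v = (THE p. p \<in> V \<and> v - p \<in> W)"

definition Proj ::
    "nat \<Rightarrow> (nat \<Rightarrow> 'x \<Rightarrow> 'a::real_vector set) \<Rightarrow> ('x \<Rightarrow> 'a set) \<Rightarrow> nat \<Rightarrow> 'x \<Rightarrow> 'a \<Rightarrow> 'a" where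
  "Proj N P Q i x = proj_along (P i x) (Q_minus N P Q i x)"

definition elog :: "real \<Rightarrow> ereal" where
  "elog r = (if r = 0 then -\<infinity> else ereal (ln r))"

definition growth_rate :: "(nat \<Rightarrow> real) \<Rightarrow> ereal" where
  "growth_rate a = limsup (\<lambda>n. ereal (1 / real n) * elog (a n))"

definition min_stretch ::
    "('a::real_normed_vector \<Rightarrow>\<^sub>L 'b::real_normed_vector) \<Rightarrow> 'a set \<Rightarrow> real" where
  "min_stretch A V = (INF v\<in>V \<inter> sphere 0 1. norm (blinfun_apply A v))"

definition char_exp ::
    "('x \<Rightarrow> 'x) \<Rightarrow> ('x \<Rightarrow> 'a::real_normed_vector \<Rightarrow>\<^sub>L 'a) \<Rightarrow> (nat \<Rightarrow> 'x \<Rightarrow> 'a set) \<Rightarrow>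
     nat \<Rightarrow> 'x \<Rightarrow> ereal" where
  "char_exp F T P i x = growth_rate (\<lambda>n. min_stretch (cocycle F T n x) (P i x))"

definition k_lyap_exp ::
    "('x \<Rightarrow> 'x) \<Rightarrow> ('x \<Rightarrow> 'a::real_normed_vector \<Rightarrow>\<^sub>L 'a) \<Rightarrow> (nat \<Rightarrow> 'x \<Rightarrow> 'a set) \<Rightarrow>
     nat \<Rightarrow> 'x \<Rightarrow> ereal" where
  "k_lyap_exp F T P i x = growth_rate (\<lambda>n. min_stretch (cocycle F T n x) (SP P i x))"

definition lyap_exp ::
    "('x \<Rightarrow> 'x) \<Rightarrow> ('x \<Rightarrow> 'a::real_normed_vector \<Rightarrow>\<^sub>L 'a) \<Rightarrow> 'x \<Rightarrow> 'a \<Rightarrow> ereal" where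
  "lyap_exp F T x v = growth_rate (\<lambda>n. norm (blinfun_apply (cocycle F T n x) v))"

end

theory Submission
  imports Defs
begin

text \<open>
  The heart of the proof is that a single invariant cone forces exponential separation of two
  bundles, one inside the cone and the other outside. Let \<open>u\<close> be a vector of \<open>P i x\<close> and \<open>w\<close>
  a vector of \<open>P (Suc i) x\<close>, or of \<open>Q x\<close> if \<open>i = N\<close>. By compactness \<open>u\<close> lies uniformly deep in
  \<open>C i\<close>, so \<open>u + w\<close> is in the cone when \<open>w\<close> is small relative to \<open>u\<close>. The cone is invariant,
  hence the images of \<open>u + w\<close> remain in it; since the second bundle meets the cone only in zero,
  the image of \<open>w\<close> cannot outgrow that of \<open>u\<close>. As the cone is even mapped into its interior,
  the component in the second bundle can be enlarged by a factor \<open>1 + \<epsilon>\<close> every two steps without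
  leaving the cone (\<open>two_step_gain\<close>), and iteration gives a geometric rate
  (\<open>exponential_separation\<close>).

  The fibres of \<open>Q\<close> may be infinite-dimensional, so their unit spheres are not compact. Compactness
  of the operators compensates for this, although it gives no control over directions of vectors
  whose images are small. The lemma \<open>transverse_bound\<close> provides what is needed: for a large bound \<open>R\<close>,
  a component ratio at most \<open>R\<close> stays at most \<open>R\<close> as long as the orbit is in the cone. With bounded ratios,
  one step yields convergent subsequences and the next one moves their limits into the interior
  (\<open>two_step_margin\<close>).

  For the first claim, separation compares the minimal stretch on \<open>P (Suc i)\<close> with that on \<open>P i\<close>
  uniformly in the base point, which gives the gap between consecutive characteristic exponents
  (\<open>char_exp_gap\<close>). The summands stay at a positive angle over the compact base, so the minimal stretch
  on \<open>SP P i\<close> is comparable with that on its last summand \<open>P i\<close>, and the two exponents in the chain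
  of inequalities are in fact equal (\<open>k_lyap_exp_eq_char_exp\<close>). For the second claim, the
  component of \<open>v\<close> with the smallest index dominates the images of all others
  (\<open>lyap_exp_Proj\<close>).
\<close>

section \<open>Subspace families with compact or closed graph\<close>

text \<open>The two notions are stated with sequences so that they apply directly in proofs by contradiction.
  A finite-dimensional continuous bundle has the first one, because bounded sequences in the moving
  fibres accumulate at the limit fibre; a codimensional bundle, whose fibres may have noncompact balls,
  has in general only the second.\<close>

definition compact_fibres :: "'x::topological_space set \<Rightarrow> ('x \<Rightarrow> 'a::real_normed_vector set) \<Rightarrow> bool" where
  "compact_fibres K U \<longleftrightarrow>
     (\<forall>X x V B. (\<forall>n. X n \<in> K \<and> V n \<in> U (X n) \<and> norm (V n) \<le> B) \<and> x \<in> K \<and> X \<longlonglongrightarrow> x \<longrightarrow>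
        (\<exists>r v. strict_mono r \<and> v \<in> U x \<and> (V \<circ> r) \<longlonglongrightarrow> v))"

definition closed_fibres :: "'x::topological_space set \<Rightarrow> ('x \<Rightarrow> 'a::real_normed_vector set) \<Rightarrow> bool" where
  "closed_fibres K W \<longleftrightarrow>
     (\<forall>X x V v. (\<forall>n. X n \<in> K \<and> V n \<in> W (X n)) \<and> x \<in> K \<and> X \<longlonglongrightarrow> x \<and> V \<longlonglongrightarrow> v \<longrightarrow> v \<in> W x)"

lemma compact_fibresD:
  assumes "compact_fibres K U" "\<And>n. X n \<in> K" "\<And>n. V n \<in> U (X n)" "\<And>n. norm (V n) \<le> B"
    "x \<in> K" "X \<longlonglongrightarrow> x"
  obtains r v where "strict_mono r" "v \<in> U x" "(V \<circ> r) \<longlonglongrightarrow> v"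
  using assms unfolding compact_fibres_def by blast

lemma closed_fibresD:
  assumes "closed_fibres K W" "\<And>n. X n \<in> K" "\<And>n. V n \<in> W (X n)" "x \<in> K" "X \<longlonglongrightarrow> x" "V \<longlonglongrightarrow> v"
  shows "v \<in> W x"
  using assms unfolding closed_fibres_def by blast

lemma compact_imp_closed_fibres:
  assumes "compact_fibres K U"
  shows "closed_fibres K U"
  unfolding closed_fibres_def
proof (intro allI impI, elim conjE)
  fix X x V v
  assume XV: "\<forall>n. X n \<in> K \<and> V n \<in> U (X n)" and x: "x \<in> K" "X \<longlonglongrightarrow> x" and V: "V \<longlonglongrightarrow> v"
  have "Bseq V" using V convergentI convergent_imp_Bseq by blast
  then obtain B where "\<And>n. norm (V n) \<le> B" unfolding Bseq_def by blast
  with XV x assms obtain r w where "strict_mono r" "w \<in> U x" "(V \<circ> r) \<longlonglongrightarrow> w"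
    by (metis compact_fibresD)
  then show "v \<in> U x" using V LIMSEQ_subseq_LIMSEQ LIMSEQ_unique by blast
qed

text \<open>Two families with compact graph that meet only in zero stay at a positive angle: a pair of
  unit-size vectors that almost cancel would converge to a common nonzero vector.\<close>

lemma uniform_angle:
  fixes K :: "'x::metric_space set"
  assumes K: "compact K"
    and U: "compact_fibres K U" "\<And>x. x \<in> K \<Longrightarrow> subspace (U x)"
    and W: "compact_fibres K W" "\<And>x. x \<in> K \<Longrightarrow> subspace (W x)"
    and UW: "\<And>x. x \<in> K \<Longrightarrow> U x \<inter> W x \<subseteq> {0}"
  obtains \<kappa> where "\<kappa> > 0" "\<And>x p q. x \<in> K \<Longrightarrow> p \<in> U x \<Longrightarrow> q \<in> W x \<Longrightarrow> \<kappa> * norm p \<le> norm (p + q)"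
proof (rule ccontr)
  assume "\<not> thesis"
  then have "\<exists>x p q. x \<in> K \<and> p \<in> U x \<and> q \<in> W x \<and> norm (p + q) < norm p / real (Suc n)" for n
    using that[of "1 / real (Suc n)"] by (force simp: not_le)
  then obtain X p q where X: "\<And>n. X n \<in> K" and p: "\<And>n. p n \<in> U (X n)" and q: "\<And>n. q n \<in> W (X n)"
    and small: "\<And>n. norm (p n + q n) < norm (p n) / real (Suc n)"
    by metis
  have pos: "norm (p n) > 0" for n
    using small[of n] norm_ge_zero[of "p n + q n"] by (smt (verit) divide_eq_0_iff zero_less_norm_iff norm_eq_zero)
  define p' where "p' n = p n /\<^sub>R norm (p n)" for n
  define q' where "q' n = q n /\<^sub>R norm (p n)" for n
  have p': "p' n \<in> U (X n)" "norm (p' n) = 1" for n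
    using p X U pos[of n] by (auto simp: p'_def subspace_scale)
  have q': "q' n \<in> W (X n)" for n
    using q X W by (auto simp: q'_def subspace_scale)
  have small': "norm (p' n + q' n) \<le> inverse (real (Suc n))" for n
  proof -
    have "norm (p' n + q' n) = norm (p n + q n) / norm (p n)"
      by (simp add: p'_def q'_def divide_inverse flip: scaleR_add_right)
    also have "\<dots> \<le> inverse (real (Suc n))"
      using small[of n] pos[of n] by (simp add: field_simps)
    finally show ?thesis .
  qed
  have q'_le: "norm (q' n) \<le> 2" for n
  proof -
    have "norm (q' n) \<le> norm (p' n + q' n) + norm (p' n)"
      by (metis add_diff_cancel_left' norm_triangle_ineq4)
    also have "\<dots> \<le> 1 + 1"
      using small'[of n] p'(2)[of n] by (smt (verit) inverse_le_1_iff of_nat_Suc of_nat_0_le_iff)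
    finally show ?thesis by simp
  qed
  obtain x r where x: "x \<in> K" "strict_mono r" "(X \<circ> r) \<longlonglongrightarrow> x"
    using K X unfolding compact_eq_seq_compact_metric by (metis seq_compactE)
  obtain r1 u where u: "strict_mono r1" "u \<in> U x" "(p' \<circ> r \<circ> r1) \<longlonglongrightarrow> u"
    using compact_fibresD[OF U(1), of "X \<circ> r" "p' \<circ> r" 1 x] X p' x by auto
  obtain r2 w where w: "strict_mono r2" "w \<in> W x" "(q' \<circ> r \<circ> r1 \<circ> r2) \<longlonglongrightarrow> w"
    using compact_fibresD[OF W(1), of "X \<circ> r \<circ> r1" "q' \<circ> r \<circ> r1" 2 x] X q' q'_le x
      LIMSEQ_subseq_LIMSEQ[OF x(3) u(1)] by auto
  have lim: "(p' \<circ> r \<circ> r1 \<circ> r2) \<longlonglongrightarrow> u" using LIMSEQ_subseq_LIMSEQ[OF u(3) w(1)] .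
  have s: "strict_mono (r \<circ> r1 \<circ> r2)" using x u w by (simp add: strict_mono_o)
  have "(\<lambda>n. p' n + q' n) \<longlonglongrightarrow> 0"
    using small' by (intro Lim_null_comparison[OF _ LIMSEQ_inverse_real_of_nat]) auto
  from LIMSEQ_subseq_LIMSEQ[OF this s] tendsto_add[OF lim w(3)] have "u + w = 0"
    by (simp add: o_def LIMSEQ_unique)
  then have "w = - u" by (metis add.inverse_unique)
  then have "u \<in> U x \<inter> W x" using u(2) w(2) W(2)[OF x(1)] subspace_neg by fastforce
  then have "u = 0" using UW x by blast
  moreover have "norm u = 1"
    using tendsto_norm[OF u(3)] p' by (simp add: o_def LIMSEQ_const_iff)
  ultimately show False by simp
qed

lemma compact_fibres_plus:
  fixes K :: "'x::metric_space set"
  assumes K: "compact K"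
    and U: "compact_fibres K U" "\<And>x. x \<in> K \<Longrightarrow> subspace (U x)"
    and W: "compact_fibres K W" "\<And>x. x \<in> K \<Longrightarrow> subspace (W x)"
    and UW: "\<And>x. x \<in> K \<Longrightarrow> U x \<inter> W x \<subseteq> {0}"
  shows "compact_fibres K (\<lambda>x. U x + W x)"
  unfolding compact_fibres_def
proof (intro allI impI, elim conjE)
  fix X x V B
  assume XV: "\<forall>n. X n \<in> K \<and> V n \<in> U (X n) + W (X n) \<and> norm (V n) \<le> B" and x: "x \<in> K" "X \<longlonglongrightarrow> x"
  obtain \<kappa> where \<kappa>: "\<kappa> > 0" "\<And>x p q. x \<in> K \<Longrightarrow> p \<in> U x \<Longrightarrow> q \<in> W x \<Longrightarrow> \<kappa> * norm p \<le> norm (p + q)"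
    using uniform_angle[OF K U W UW] by metis
  have "\<exists>p q. p \<in> U (X n) \<and> q \<in> W (X n) \<and> V n = p + q" for n
    using XV set_plus_elim by metis
  then obtain p q where p: "\<And>n. p n \<in> U (X n)" and q: "\<And>n. q n \<in> W (X n)" and V: "\<And>n. V n = p n + q n"
    by metis
  have pB: "norm (p n) \<le> B / \<kappa>" for n
  proof -
    have "\<kappa> * norm (p n) \<le> B"
      using \<kappa>(2)[of "X n" "p n" "q n"] p q V XV by (metis order_trans)
    then show ?thesis using \<kappa>(1) by (simp add: field_simps)
  qed
  have qB: "norm (q n) \<le> B + B / \<kappa>" for n
    using XV pB[of n] V[of n] by (metis add_diff_cancel_left' add_mono norm_triangle_ineq4 order_trans)
  obtain r u where u: "strict_mono r" "u \<in> U x" "(p \<circ> r) \<longlonglongrightarrow> u"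
    using compact_fibresD[OF U(1), of X p "B / \<kappa>" x] XV p pB x by metis
  obtain r' w where w: "strict_mono r'" "w \<in> W x" "(q \<circ> r \<circ> r') \<longlonglongrightarrow> w"
    using compact_fibresD[OF W(1), of "X \<circ> r" "q \<circ> r" "B + B / \<kappa>" x] XV q qB x
      LIMSEQ_subseq_LIMSEQ[OF x(2) u(1)] by auto
  have "(V \<circ> (r \<circ> r')) \<longlonglongrightarrow> u + w"
    using tendsto_add[OF LIMSEQ_subseq_LIMSEQ[OF u(3) w(1)] w(3)] V by (simp add: o_def)
  moreover have "strict_mono (r \<circ> r')" using u w by (simp add: strict_mono_o)
  ultimately show "\<exists>r v. strict_mono r \<and> v \<in> U x + W x \<and> (V \<circ> r) \<longlonglongrightarrow> v"
    using u(2) w(2) by blast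
qed

text \<open>The one-point base set serves to read a single subspace as a constant family.\<close>

lemma compact_fibres_line: "compact_fibres {0::real} (\<lambda>_. span {b})"
  unfolding compact_fibres_def
proof (intro allI impI, elim conjE)
  fix X :: "nat \<Rightarrow> real" and x and V :: "nat \<Rightarrow> 'a" and B
  assume V: "\<forall>n. X n \<in> {0::real} \<and> V n \<in> span {b} \<and> norm (V n) \<le> B"
  show "\<exists>r v. strict_mono r \<and> v \<in> span {b} \<and> (V \<circ> r) \<longlonglongrightarrow> v"
  proof (cases "b = 0")
    case True
    then have "V = (\<lambda>_. 0)" using V by auto
    then show ?thesis by (intro exI[of _ id] exI[of _ 0]) (auto simp: strict_mono_id span_zero)
  next
    case False
    have "\<exists>k. V n = k *\<^sub>R b" for n using V by (auto simp: span_singleton)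
    then obtain c where c: "\<And>n. V n = c n *\<^sub>R b" by metis
    have "\<bar>c n\<bar> \<le> B / norm b" for n
      using V c[of n] False by (metis norm_scaleR pos_le_divide_eq zero_less_norm_iff)
    then have "\<forall>n. c n \<in> {-(B / norm b)..B / norm b}" by (auto simp: abs_le_iff minus_le_iff)
    then obtain l r where "strict_mono r" "(c \<circ> r) \<longlonglongrightarrow> l"
      using compact_Icc[of "-(B / norm b)" "B / norm b"] unfolding compact_eq_seq_compact_metric
      by (metis seq_compactE)
    moreover have "(V \<circ> r) = (\<lambda>n. (c \<circ> r) n *\<^sub>R b)" by (auto simp: c)
    ultimately show ?thesis
      by (intro exI[of _ r] exI[of _ "l *\<^sub>R b"]) (auto simp: span_singleton o_def intro!: tendsto_intros)
  qed
qed

text \<open>Applied to constant families, the previous lemmas build every finite-dimensional subspace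
  from lines, which gives the Heine-Borel property in a general normed space.\<close>

lemma finite_dim_convergent_subseq:
  fixes H :: "'a::real_normed_vector set" and V :: "nat \<Rightarrow> 'a"
  assumes "finite_dim H" "\<And>n. V n \<in> H" "\<And>n. norm (V n) \<le> B"
  obtains r v where "strict_mono r" "v \<in> H" "(V \<circ> r) \<longlonglongrightarrow> v"
proof -
  have "compact_fibres {0::real} (\<lambda>_. span S)" if "finite S" for S :: "'a set"
    using that
  proof (induction S rule: finite_induct)
    case empty
    then show ?case using compact_fibres_line[of "0::'a"] by simp
  next
    case (insert b S)
    show ?case
    proof (cases "b \<in> span S")
      case True
      then show ?thesis using insert by (simp add: span_redundant)
    next
      case False
      have "span {b} \<inter> span S \<subseteq> {0}"
      proof
        fix v assume "v \<in> span {b} \<inter> span S"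
        then obtain c where c: "v = c *\<^sub>R b" "c *\<^sub>R b \<in> span S" by (auto simp: span_singleton)
        then have "c = 0" using False span_scale[of "c *\<^sub>R b" S "inverse c"] by (cases "c = 0") auto
        then show "v \<in> {0}" using c by simp
      qed
      then have "compact_fibres {0::real} (\<lambda>_. span {b} + span S)"
        using insert compact_fibres_line by (intro compact_fibres_plus) (auto simp: subspace_span)
      moreover have "span {b} + span S = span (insert b S)"
        using span_Un[of "{b}" S] by (auto simp: set_plus_def)
      ultimately show ?thesis by simp
    qed
  qed
  moreover obtain S where "finite S" "span S = H" using assms(1) by (auto simp: finite_dim_def)
  ultimately have "compact_fibres {0::real} (\<lambda>_. H)" by auto
  then show ?thesis
    using compact_fibresD[of "{0::real}" "\<lambda>_. H" "\<lambda>_. 0" V B "0"] assms that by auto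
qed

lemma G_unit_vector:
  fixes H :: "'a::real_normed_vector set"
  assumes "H \<in> G d" "d > 0"
  obtains v where "v \<in> H" "norm v = 1"
proof -
  have "\<exists>v\<in>H. v \<noteq> 0"
  proof (rule ccontr)
    assume "\<not> ?thesis"
    then have "H \<subseteq> span {}" by auto
    then have "dim H \<le> card ({} :: 'a set)" by (intro dim_le_card) auto
    then show False using assms by (simp add: G_def)
  qed
  then obtain v where "v \<in> H" "v \<noteq> 0" by blast
  moreover have "subspace H" using assms by (auto simp: G_def finite_dim_def)
  ultimately show ?thesis by (intro that[of "v /\<^sub>R norm v"]) (auto simp: subspace_scale)
qed

lemma gap_commute: "gap A B = gap B A"
  by (simp add: gap_def max.commute)

text \<open>The inner infimum in the gap is at most 2 on unit vectors, so the supremum is over a bounded set and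
  does bound each of its members.\<close>

lemma gap_approximate:
  assumes "gap A B < e" "v \<in> A" "norm v = 1" "B \<inter> sphere 0 1 \<noteq> {}"
  obtains u where "u \<in> B" "norm u = 1" "norm (v - u) < e"
proof -
  let ?f = "\<lambda>v. INF u\<in>B \<inter> sphere 0 1. norm (v - u)"
  have bdd: "bdd_below ((\<lambda>u. norm (w - u)) ` (B \<inter> sphere 0 1))" for w
    by (intro bdd_belowI2[of _ 0]) auto
  obtain u0 where u0: "u0 \<in> B" "norm u0 = 1" using assms(4) by auto
  have le2: "?f w \<le> 2" if "norm w = 1" for w
  proof -
    have "?f w \<le> norm (w - u0)" using u0 by (intro cINF_lower bdd) auto
    also have "\<dots> \<le> norm w + norm u0" by (rule norm_triangle_ineq4)
    finally show ?thesis using that u0 by simp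
  qed
  have "?f v \<le> (SUP w\<in>A \<inter> sphere 0 1. ?f w)"
    using assms le2 by (intro cSUP_upper bdd_aboveI2[where M = 2]) auto
  also have "\<dots> < e" using assms(1) by (simp add: gap_def)
  finally show ?thesis using cINF_less_iff[OF assms(4) bdd] that by auto
qed

lemma gap_self:
  assumes "A \<inter> sphere 0 1 \<noteq> {}"
  shows "gap A A = 0"
proof -
  have "(INF u\<in>A \<inter> sphere 0 1. norm (w - u)) = 0" if "w \<in> A \<inter> sphere 0 1" for w
  proof (rule antisym)
    have "(INF u\<in>A \<inter> sphere 0 1. norm (w - u)) \<le> norm (w - w)"
      using that by (intro cINF_lower bdd_belowI2[of _ 0]) auto
    then show "(INF u\<in>A \<inter> sphere 0 1. norm (w - u)) \<le> 0" by simp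
    show "0 \<le> (INF u\<in>A \<inter> sphere 0 1. norm (w - u))"
      using that by (intro cINF_greatest) auto
  qed
  then have "(SUP w\<in>A \<inter> sphere 0 1. INF u\<in>A \<inter> sphere 0 1. norm (w - u)) = (SUP w\<in>A \<inter> sphere 0 1. 0)"
    by (intro SUP_cong) auto
  also have "\<dots> = 0" using assms by (subst cSUP_const) auto
  finally show ?thesis by (simp add: gap_def)
qed

lemma dim_bundle_sphere_nonempty:
  assumes "dim_bundle K d P" "d > 0" "x \<in> K"
  shows "P x \<inter> sphere 0 1 \<noteq> {}"
proof -
  have "P x \<in> G d" using assms by (auto simp: dim_bundle_def)
  then obtain v where "v \<in> P x" "norm v = 1" using G_unit_vector assms(2) by blast
  then show ?thesis by auto
qed

text \<open>The continuity of a bundle is given by a punctured limit, whereas sequences may hit their limit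
  point; there the gap vanishes.\<close>

lemma dim_bundle_gap_tendsto:
  fixes K :: "'x::metric_space set"
  assumes P: "dim_bundle K d P" and d: "d > 0"
    and X: "\<And>n. X n \<in> K" "x \<in> K" "X \<longlonglongrightarrow> x"
  shows "(\<lambda>n. gap (P (X n)) (P x)) \<longlonglongrightarrow> 0"
proof -
  have g: "gap (P x) (P x) = 0" using gap_self dim_bundle_sphere_nonempty[OF P d] X by blast
  have "((\<lambda>y. gap (P y) (P x)) \<longlongrightarrow> 0) (at x within K)" using P X by (auto simp: dim_bundle_def)
  then have "continuous (at x within K) (\<lambda>y. gap (P y) (P x))" by (simp add: continuous_within g)
  then show ?thesis using X g by (auto simp: continuous_within_sequentially o_def)
qed

text \<open>The gap moves each vector of a nearby fibre into the limit fibre at small cost, and bounded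
  sequences in that finite-dimensional space have convergent subsequences.\<close>

lemma dim_bundle_compact_fibres:
  fixes K :: "'x::metric_space set"
  assumes P: "dim_bundle K d P" and d: "d > 0"
  shows "compact_fibres K P"
  unfolding compact_fibres_def
proof (intro allI impI, elim conjE)
  fix X x V B
  assume XV: "\<forall>n. X n \<in> K \<and> V n \<in> P (X n) \<and> norm (V n) \<le> B" and x: "x \<in> K" "X \<longlonglongrightarrow> x"
  have sub: "subspace (P y)" if "y \<in> K" for y
    using P that by (auto simp: dim_bundle_def G_def finite_dim_def)
  define g where "g n = gap (P (X n)) (P x) + inverse (real (Suc n))" for n
  have lim_gap: "(\<lambda>n. gap (P (X n)) (P x)) \<longlonglongrightarrow> 0"
    using dim_bundle_gap_tendsto[OF P d] XV x by blast
  have lim_g: "g \<longlonglongrightarrow> 0"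
    using tendsto_add[OF lim_gap LIMSEQ_inverse_real_of_nat] unfolding g_def[abs_def] by simp
  have "\<exists>u. u \<in> P x \<and> norm (V n - u) \<le> B * g n" for n
  proof (cases "V n = 0")
    case True
    have "gap (P (X n)) (P x) \<ge> 0"
    proof -
      obtain v where v: "v \<in> P (X n)" "norm v = 1"
        using G_unit_vector[of "P (X n)" d] P d XV by (auto simp: dim_bundle_def)
      obtain u where "u \<in> P x" "norm u = 1"
        using G_unit_vector[of "P x" d] P d x by (auto simp: dim_bundle_def)
      then have "P x \<inter> sphere 0 1 \<noteq> {}" by auto
      show ?thesis
        using gap_approximate[OF _ v \<open>P x \<inter> sphere 0 1 \<noteq> {}\<close>, of 0] by fastforce
    qed
    moreover have "0 \<le> B" using XV by (meson norm_ge_zero order_trans)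
    ultimately have "0 \<le> B * g n" by (auto simp: g_def)
    then show ?thesis using True sub x by (intro exI[of _ 0]) (auto simp: subspace_0)
  next
    case False
    define v where "v = V n /\<^sub>R norm (V n)"
    have v: "v \<in> P (X n)" "norm v = 1" using False XV sub by (auto simp: v_def subspace_scale)
    obtain u where "u \<in> P x" "norm u = 1"
      using G_unit_vector[of "P x" d] P d x by (auto simp: dim_bundle_def)
    then have "P x \<inter> sphere 0 1 \<noteq> {}" by auto
    then obtain u where u: "u \<in> P x" "norm (v - u) < g n"
      using gap_approximate[of "P (X n)" "P x" "g n" v] v by (auto simp: g_def)
    have "norm (V n - norm (V n) *\<^sub>R u) = norm (norm (V n) *\<^sub>R (v - u))"
      using False by (simp add: v_def algebra_simps)
    also have "\<dots> = norm (V n) * norm (v - u)" by simp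
    also have "\<dots> \<le> B * g n" using u XV by (intro mult_mono) (auto intro: order_trans[OF norm_ge_zero])
    finally show ?thesis using u sub x by (intro exI[of _ "norm (V n) *\<^sub>R u"]) (auto simp: subspace_scale)
  qed
  then obtain u where u: "\<And>n. u n \<in> P x" "\<And>n. norm (V n - u n) \<le> B * g n" by metis
  have lim_diff: "(\<lambda>n. V n - u n) \<longlonglongrightarrow> 0"
    by (rule Lim_null_comparison[OF always_eventually tendsto_mult_right_zero[OF lim_g, of B]]) (use u(2) in blast)
  then have "Bseq (\<lambda>n. V n - u n)" using convergentI convergent_imp_Bseq by blast
  then obtain M where M: "\<And>n. norm (V n - u n) \<le> M" unfolding Bseq_def by blast
  have "norm (u n) \<le> B + M" for n
  proof -
    have "norm (u n) \<le> norm (V n) + norm (V n - u n)"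
      using norm_triangle_ineq4[of "V n" "V n - u n"] by simp
    also have "\<dots> \<le> B + M" using XV M by (intro add_mono) auto
    finally show ?thesis .
  qed
  moreover have "finite_dim (P x)" using P x by (auto simp: dim_bundle_def G_def)
  ultimately obtain r v where r: "strict_mono r" "v \<in> P x" "(u \<circ> r) \<longlonglongrightarrow> v"
    using finite_dim_convergent_subseq u(1) by metis
  have "(V \<circ> r) \<longlonglongrightarrow> v"
    using tendsto_add[OF LIMSEQ_subseq_LIMSEQ[OF lim_diff r(1)] r(3)] by (simp add: o_def)
  then show "\<exists>r v. strict_mono r \<and> v \<in> P x \<and> (V \<circ> r) \<longlonglongrightarrow> v" using r by blast
qed

text \<open>Every functional annihilating the limit fibre is a norm limit of functionals annihilating the
  nearby fibres, so it also annihilates limits of vectors taken from them.\<close>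

lemma codim_bundle_closed_fibres:
  fixes K :: "'x::metric_space set"
  assumes Q: "codim_bundle K d Q" and d: "d > 0"
  shows "closed_fibres K Q"
  unfolding closed_fibres_def
proof (intro allI impI, elim conjE)
  fix X x V v
  assume XV: "\<forall>n. X n \<in> K \<and> V n \<in> Q (X n)" and x: "x \<in> K" "X \<longlonglongrightarrow> x" and V: "V \<longlonglongrightarrow> v"
  obtain L where L: "dim_bundle K d L" and Ker: "\<And>y. y \<in> K \<Longrightarrow> Ker (L y) = Q y"
    using Q by (auto simp: codim_bundle_def)
  have gap: "(\<lambda>n. gap (L x) (L (X n)) + inverse (real (Suc n))) \<longlonglongrightarrow> 0"
    using tendsto_add[OF dim_bundle_gap_tendsto[OF L d, of X x] LIMSEQ_inverse_real_of_nat] XV x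
    by (simp add: gap_commute)
  have unit: "blinfun_apply l v = 0" if l: "l \<in> L x" "norm l = 1" for l
  proof -
    have "\<exists>m. m \<in> L (X n) \<and> norm (l - m) < gap (L x) (L (X n)) + inverse (real (Suc n))" for n
    proof -
      have "L (X n) \<inter> sphere 0 1 \<noteq> {}" using dim_bundle_sphere_nonempty[OF L d] XV by blast
      then obtain m where "m \<in> L (X n)" "norm (l - m) < gap (L x) (L (X n)) + inverse (real (Suc n))"
        using gap_approximate[of "L x" "L (X n)" "gap (L x) (L (X n)) + inverse (real (Suc n))" l] l by auto
      then show ?thesis by blast
    qed
    then obtain m where m: "\<And>n. m n \<in> L (X n)"
      and lm: "\<And>n. norm (l - m n) < gap (L x) (L (X n)) + inverse (real (Suc n))" by metis
    have "(\<lambda>n. l - m n) \<longlonglongrightarrow> 0"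
      by (rule Lim_null_comparison[OF always_eventually gap]) (use lm less_imp_le in blast)
    from tendsto_diff[OF tendsto_const[of l] this] have "m \<longlonglongrightarrow> l" by simp
    then have "(\<lambda>n. blinfun_apply (m n) (V n)) \<longlonglongrightarrow> blinfun_apply l v"
      using V by (intro tendsto_intros)
    moreover have "blinfun_apply (m n) (V n) = 0" for n
      using Ker[of "X n"] XV m[of n] by (auto simp: Ker_def)
    ultimately show ?thesis by (simp add: LIMSEQ_const_iff)
  qed
  have "subspace (L x)" using L x by (auto simp: dim_bundle_def G_def finite_dim_def)
  have "blinfun_apply l v = 0" if l: "l \<in> L x" for l
  proof (cases "l = 0")
    case False
    then have "blinfun_apply (l /\<^sub>R norm l) v = 0"
      using l \<open>subspace (L x)\<close> by (intro unit) (auto simp: subspace_scale)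
    then show ?thesis using False by (simp add: blinfun.scaleR_left)
  qed simp
  then have "v \<in> Ker (L x)" by (simp add: Ker_def)
  then show "v \<in> Q x" using Ker x by simp
qed

section \<open>Exponential separation by an invariant cone\<close>

text \<open>The product form covers zero vectors and avoids normalisation; the constant is uniform over the
  base, the rate \<open>\<gamma>\<close> is a parameter because it reappears in the gap between exponents.\<close>

definition exp_separated ::
    "'x set \<Rightarrow> ('x \<Rightarrow> 'x) \<Rightarrow> ('x \<Rightarrow> 'a::real_normed_vector \<Rightarrow>\<^sub>L 'a) \<Rightarrow> real \<Rightarrow>
     ('x \<Rightarrow> 'a set) \<Rightarrow> ('x \<Rightarrow> 'a set) \<Rightarrow> bool" where
  "exp_separated K F T \<gamma> U W \<longleftrightarrow>
     0 < \<gamma> \<and> \<gamma> < 1 \<and>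
     (\<exists>M>0. \<forall>x\<in>K. \<forall>u\<in>U x. \<forall>w\<in>W x. \<forall>n.
        norm (cocycle F T n x w) * norm u \<le> M * \<gamma> ^ n * (norm (cocycle F T n x u) * norm w))"

text \<open>Comparing both sides with a nonzero vector of the middle family multiplies the two rates; without
  such a vector the two hypotheses would be vacuous.\<close>

lemma exp_separated_trans:
  assumes UV: "exp_separated K F T \<gamma> U V" and VW: "exp_separated K F T \<gamma>' V W"
    and V: "\<And>x. x \<in> K \<Longrightarrow> \<exists>v\<in>V x. v \<noteq> 0"
  shows "exp_separated K F T (\<gamma> * \<gamma>') U W"
proof -
  obtain M M' where M: "M > 0" "M' > 0"
    and UV': "\<And>x u v n. x \<in> K \<Longrightarrow> u \<in> U x \<Longrightarrow> v \<in> V x \<Longrightarrow>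
      norm (cocycle F T n x v) * norm u \<le> M * \<gamma> ^ n * (norm (cocycle F T n x u) * norm v)"
    and VW': "\<And>x v w n. x \<in> K \<Longrightarrow> v \<in> V x \<Longrightarrow> w \<in> W x \<Longrightarrow>
      norm (cocycle F T n x w) * norm v \<le> M' * \<gamma>' ^ n * (norm (cocycle F T n x v) * norm w)"
    using UV VW unfolding exp_separated_def by metis
  have \<gamma>: "0 < \<gamma>" "\<gamma> < 1" "0 < \<gamma>'" "\<gamma>' < 1" using UV VW by (auto simp: exp_separated_def)
  have "norm (cocycle F T n x w) * norm u \<le> M * M' * (\<gamma> * \<gamma>') ^ n * (norm (cocycle F T n x u) * norm w)"
    if xuw: "x \<in> K" "u \<in> U x" "w \<in> W x" for x u w n
  proof -
    let ?T = "\<lambda>v. norm (cocycle F T n x v)"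
    obtain v where v: "v \<in> V x" "v \<noteq> 0" using V xuw by blast
    have "(?T w * norm u) * norm v = (?T w * norm v) * norm u" by simp
    also have "\<dots> \<le> (M' * \<gamma>' ^ n * (?T v * norm w)) * norm u"
      using VW' xuw v by (intro mult_right_mono) auto
    also have "\<dots> = (?T v * norm u) * (M' * \<gamma>' ^ n * norm w)" by simp
    also have "\<dots> \<le> (M * \<gamma> ^ n * (?T u * norm v)) * (M' * \<gamma>' ^ n * norm w)"
      using UV' xuw v M \<gamma> by (intro mult_right_mono) auto
    also have "\<dots> = (M * M' * (\<gamma> * \<gamma>') ^ n * (?T u * norm w)) * norm v"
      by (simp add: power_mult_distrib)
    finally show ?thesis using v by simp
  qed
  moreover have "\<gamma> * \<gamma>' < 1" using \<gamma> mult_strict_mono[of \<gamma> 1 \<gamma>' 1] by simp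
  moreover have "M * M' > 0" using M by simp
  ultimately show ?thesis using \<gamma> unfolding exp_separated_def by auto
qed

lemma exp_separated_quotient_tendsto_0:
  assumes sep: "exp_separated K F T \<gamma> U W" and x: "x \<in> K" "u \<in> U x" "u \<noteq> 0" "w \<in> W x"
    and nz: "\<And>n. cocycle F T n x u \<noteq> 0"
  shows "(\<lambda>n. norm (cocycle F T n x w) / norm (cocycle F T n x u)) \<longlonglongrightarrow> 0"
proof -
  obtain M where M: "\<And>n. norm (cocycle F T n x w) * norm u \<le> M * \<gamma> ^ n * (norm (cocycle F T n x u) * norm w)"
    using sep x unfolding exp_separated_def by blast
  have \<gamma>: "0 < \<gamma>" "\<gamma> < 1" using sep by (auto simp: exp_separated_def)
  have "norm (norm (cocycle F T n x w) / norm (cocycle F T n x u)) \<le> \<gamma> ^ n * (M * norm w / norm u)" for n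
    using M[of n] nz[of n] x by (simp add: field_simps)
  moreover have "(\<lambda>n. \<gamma> ^ n * (M * norm w / norm u)) \<longlonglongrightarrow> 0"
    using \<gamma> by (intro tendsto_mult_left_zero LIMSEQ_realpow_zero) auto
  ultimately show ?thesis by (rule Lim_null_comparison[OF always_eventually[OF allI]])
qed

locale compact_cocycle =
  fixes K :: "'x::metric_space set" and F :: "'x \<Rightarrow> 'x" and T :: "'x \<Rightarrow> 'a::real_normed_vector \<Rightarrow>\<^sub>L 'a"
  assumes compact_base: "compact K"
    and F_into: "x \<in> K \<Longrightarrow> F x \<in> K"
    and F_cont: "continuous_on K F"
    and T_cont: "continuous_on K T"
    and T_compact: "x \<in> K \<Longrightarrow> compact_operator (T x)"
begin

lemma F_tendsto: "(\<And>n. X n \<in> K) \<Longrightarrow> x \<in> K \<Longrightarrow> X \<longlonglongrightarrow> x \<Longrightarrow> (\<lambda>n. F (X n)) \<longlonglongrightarrow> F x"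
  using F_cont continuous_on_tendsto_compose by fastforce

lemma T_tendsto: "(\<And>n. X n \<in> K) \<Longrightarrow> x \<in> K \<Longrightarrow> X \<longlonglongrightarrow> x \<Longrightarrow> (\<lambda>n. T (X n)) \<longlonglongrightarrow> T x"
  using T_cont continuous_on_tendsto_compose by fastforce

lemma T_apply_tendsto:
  "(\<And>n. X n \<in> K) \<Longrightarrow> x \<in> K \<Longrightarrow> X \<longlonglongrightarrow> x \<Longrightarrow> V \<longlonglongrightarrow> v \<Longrightarrow> (\<lambda>n. T (X n) (V n)) \<longlonglongrightarrow> T x v"
  by (intro tendsto_intros T_tendsto)

lemma base_subseq:
  fixes X :: "nat \<Rightarrow> 'x"
  assumes "\<And>n. X n \<in> K"
  obtains r x where "strict_mono r" "x \<in> K" "(X \<circ> r) \<longlonglongrightarrow> x"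
proof -
  have "seq_compact K" using compact_base by (simp add: compact_eq_seq_compact_metric)
  then show ?thesis using seq_compactE[of K X] assms that by blast
qed

lemma T_bounded: obtains A where "A > 0" "\<And>x. x \<in> K \<Longrightarrow> norm (T x) \<le> A"
proof -
  have "bounded (T ` K)" using compact_continuous_image[OF T_cont compact_base] compact_imp_bounded by blast
  then show ?thesis using that by (auto simp: bounded_pos)
qed

text \<open>Norm continuity over a compact base makes the operators collectively compact.\<close>

lemma T_image_subseq:
  assumes X: "\<And>n. X n \<in> K" "x \<in> K" "X \<longlonglongrightarrow> x" and b: "\<And>n. norm (b n) \<le> B"
  obtains r z where "strict_mono r" "(\<lambda>n. T (X (r n)) (b (r n))) \<longlonglongrightarrow> z"
proof -
  define c where "c = max B 1"
  have c: "c > 0" "\<And>n. norm (b n) \<le> c" using b by (auto simp: c_def intro: le_max_iff_disj[THEN iffD2])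
  have "compact (closure (T x ` cball 0 1))" using T_compact X by (auto simp: compact_operator_def)
  moreover have "T x (b n /\<^sub>R c) \<in> closure (T x ` cball 0 1)" for n
  proof -
    have "norm (b n /\<^sub>R c) \<le> 1" using c(1) c(2)[of n] by (simp add: field_simps)
    then show ?thesis by (intro subsetD[OF closure_subset] imageI) auto
  qed
  ultimately obtain z r where r: "strict_mono r" "((\<lambda>n. T x (b n /\<^sub>R c)) \<circ> r) \<longlonglongrightarrow> z"
    unfolding compact_eq_seq_compact_metric
    using seq_compactE[of "closure (T x ` cball 0 1)" "\<lambda>n. T x (b n /\<^sub>R c)"] by blast
  from tendsto_scaleR[OF tendsto_const[of c] r(2)] have z: "(\<lambda>n. T x (b (r n))) \<longlonglongrightarrow> c *\<^sub>R z"
    using c(1) by (simp add: o_def blinfun.scaleR_right)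
  have "norm ((T (X n) - T x) (b n)) \<le> norm (T (X n) - T x) * c" for n
    by (meson c(2) mult_left_mono norm_blinfun norm_ge_zero order_trans)
  moreover have "(\<lambda>n. norm (T (X n) - T x) * c) \<longlonglongrightarrow> 0"
    using T_tendsto[OF X] by (intro tendsto_mult_left_zero tendsto_norm_zero) (simp add: LIM_zero_iff)
  ultimately have "(\<lambda>n. (T (X n) - T x) (b n)) \<longlonglongrightarrow> 0"
    by (rule Lim_null_comparison[OF always_eventually[OF allI]])
  from tendsto_add[OF LIMSEQ_subseq_LIMSEQ[OF this r(1)] z]
  have "(\<lambda>n. T (X (r n)) (b (r n))) \<longlonglongrightarrow> c *\<^sub>R z"
    by (simp add: o_def blinfun.diff_left)
  with r(1) show ?thesis by (rule that)
qed

lemma F_funpow_into: "x \<in> K \<Longrightarrow> (F ^^ n) x \<in> K"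
  by (induction n) (auto intro: F_into)

lemma cocycle_into:
  assumes "\<And>x v. x \<in> K \<Longrightarrow> v \<in> U x \<Longrightarrow> T x v \<in> U (F x)" "x \<in> K" "v \<in> U x"
  shows "cocycle F T n x v \<in> U ((F ^^ n) x)"
  by (induction n) (auto intro: assms F_funpow_into)

lemma cocycle_nonzero:
  assumes "\<And>x v. x \<in> K \<Longrightarrow> v \<in> U x \<Longrightarrow> T x v \<in> U (F x)"
    "\<And>x v. x \<in> K \<Longrightarrow> v \<in> U x \<Longrightarrow> T x v = 0 \<Longrightarrow> v = 0" "x \<in> K" "v \<in> U x" "v \<noteq> 0"
  shows "cocycle F T n x v \<noteq> 0"
proof (induction n)
  case (Suc n)
  have "cocycle F T n x v \<in> U ((F ^^ n) x)" using cocycle_into assms by blast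
  then show ?case using Suc assms(2) F_funpow_into[OF assms(3)] by auto
qed (use assms in simp)

end

text \<open>The setting in which a cone forces separation: \<open>U\<close> lies inside the cone, \<open>W\<close> meets
  it only in zero. Compactness is required of \<open>U\<close> but only closedness of \<open>W\<close>, so that \<open>W\<close> may
  be a finite-dimensional bundle as well as a bundle of finite codimension.\<close>

locale cone_separation = compact_cocycle K F T
  for K :: "'x::metric_space set" and F :: "'x \<Rightarrow> 'x" and T :: "'x \<Rightarrow> 'a::real_normed_vector \<Rightarrow>\<^sub>L 'a" +
  fixes C :: "'a set" and U W :: "'x \<Rightarrow> 'a set"
  assumes C_closed: "closed C"
    and C_zero: "0 \<in> C"
    and C_scale: "v \<in> C \<Longrightarrow> r *\<^sub>R v \<in> C"
    and C_invariant: "x \<in> K \<Longrightarrow> v \<in> C \<Longrightarrow> v \<noteq> 0 \<Longrightarrow> T x v \<in> interior C"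
    and U_subspace: "x \<in> K \<Longrightarrow> subspace (U x)"
    and U_compact: "compact_fibres K U"
    and U_interior: "x \<in> K \<Longrightarrow> u \<in> U x \<Longrightarrow> u \<noteq> 0 \<Longrightarrow> u \<in> interior C"
    and U_invariant: "x \<in> K \<Longrightarrow> u \<in> U x \<Longrightarrow> T x u \<in> U (F x)"
    and U_injective: "x \<in> K \<Longrightarrow> u \<in> U x \<Longrightarrow> T x u = 0 \<Longrightarrow> u = 0"
    and W_subspace: "x \<in> K \<Longrightarrow> subspace (W x)"
    and W_closed: "closed_fibres K W"
    and W_outside: "x \<in> K \<Longrightarrow> w \<in> W x \<Longrightarrow> w \<in> C \<Longrightarrow> w = 0"
    and W_invariant: "x \<in> K \<Longrightarrow> w \<in> W x \<Longrightarrow> T x w \<in> W (F x)"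
begin

lemma C_image: "x \<in> K \<Longrightarrow> v \<in> C \<Longrightarrow> T x v \<in> C"
  using C_invariant interior_subset C_zero by (cases "v = 0") auto

lemma U_unit_subseq:
  fixes X :: "nat \<Rightarrow> 'x" and a :: "nat \<Rightarrow> 'a"
  assumes "\<And>n. X n \<in> K" "\<And>n. a n \<in> U (X n)" "\<And>n. norm (a n) = 1"
  obtains r x u where "strict_mono r" "x \<in> K" "(X \<circ> r) \<longlonglongrightarrow> x" "u \<in> U x" "(a \<circ> r) \<longlonglongrightarrow> u" "norm u = 1"
proof -
  obtain r x where r: "strict_mono r" "x \<in> K" "(X \<circ> r) \<longlonglongrightarrow> x" using base_subseq[of X, OF assms(1)] .
  obtain r' u where r': "strict_mono r'" "u \<in> U x" "(a \<circ> r \<circ> r') \<longlonglongrightarrow> u"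
    using compact_fibresD[OF U_compact, of "X \<circ> r" "a \<circ> r" 1 x] assms r by auto
  have "norm u = 1" using tendsto_norm[OF r'(3)] assms(3) by (simp add: o_def LIMSEQ_const_iff)
  show ?thesis
  proof
    show "strict_mono (r \<circ> r')" using r r' by (simp add: strict_mono_o)
    show "(X \<circ> (r \<circ> r')) \<longlonglongrightarrow> x" using LIMSEQ_subseq_LIMSEQ[OF r(3) r'(1)] by (simp add: o_assoc)
    show "(a \<circ> (r \<circ> r')) \<longlonglongrightarrow> u" using r'(3) by (simp add: o_assoc)
  qed fact+
qed

lemma U_lower_bound:
  obtains m where "m > 0" "\<And>x u. x \<in> K \<Longrightarrow> u \<in> U x \<Longrightarrow> m * norm u \<le> norm (T x u)"
proof -
  have "\<exists>m>0. \<forall>x\<in>K. \<forall>u\<in>U x. norm u = 1 \<longrightarrow> m \<le> norm (T x u)"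
  proof (rule ccontr)
    assume "\<not> ?thesis"
    then have "\<exists>x u. x \<in> K \<and> u \<in> U x \<and> norm u = 1 \<and> norm (T x u) < inverse (real (Suc n))" for n
      by (metis inverse_positive_iff_positive not_le of_nat_0_less_iff zero_less_Suc)
    then obtain X a where X: "\<And>n. X n \<in> K" "\<And>n. a n \<in> U (X n)" "\<And>n. norm (a n) = 1"
      and small: "\<And>n. norm (T (X n) (a n)) < inverse (real (Suc n))" by metis
    obtain r x u where r: "strict_mono r" "x \<in> K" "(X \<circ> r) \<longlonglongrightarrow> x" "u \<in> U x" "(a \<circ> r) \<longlonglongrightarrow> u" "norm u = 1"
      using U_unit_subseq[OF X] .
    have "(\<lambda>n. T (X n) (a n)) \<longlonglongrightarrow> 0"
      by (rule Lim_null_comparison[OF always_eventually LIMSEQ_inverse_real_of_nat])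
        (use small less_imp_le in blast)
    from LIMSEQ_subseq_LIMSEQ[OF this r(1)] T_apply_tendsto[OF _ r(2,3,5)] X(1)
    have "T x u = 0" by (simp add: o_def LIMSEQ_unique)
    then show False using U_injective r by fastforce
  qed
  then obtain m where m: "m > 0" "\<And>x u. x \<in> K \<Longrightarrow> u \<in> U x \<Longrightarrow> norm u = 1 \<Longrightarrow> m \<le> norm (T x u)" by blast
  have "m * norm u \<le> norm (T x u)" if "x \<in> K" "u \<in> U x" for x u
  proof (cases "u = 0")
    case False
    then have "m \<le> norm (T x (u /\<^sub>R norm u))"
      using that U_subspace by (intro m) (auto simp: subspace_scale)
    then show ?thesis using False by (simp add: blinfun.scaleR_right field_simps)
  qed simp
  with m(1) show ?thesis by (rule that)
qed

lemma U_uniformly_interior: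
  obtains \<delta> where "\<delta> > 0" "\<And>x u e. x \<in> K \<Longrightarrow> u \<in> U x \<Longrightarrow> norm e \<le> \<delta> * norm u \<Longrightarrow> u + e \<in> C"
proof -
  have "\<exists>\<delta>>0. \<forall>x\<in>K. \<forall>u\<in>U x. \<forall>e. norm u = 1 \<longrightarrow> norm e \<le> \<delta> \<longrightarrow> u + e \<in> C"
  proof (rule ccontr)
    assume "\<not> ?thesis"
    then have "\<exists>x u e. x \<in> K \<and> u \<in> U x \<and> norm u = 1 \<and> norm e \<le> inverse (real (Suc n)) \<and> u + e \<notin> C" for n
      by (metis inverse_positive_iff_positive of_nat_0_less_iff zero_less_Suc)
    then obtain X a e where X: "\<And>n. X n \<in> K" "\<And>n. a n \<in> U (X n)" "\<And>n. norm (a n) = 1"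
      and small: "\<And>n. norm (e n) \<le> inverse (real (Suc n))" and out: "\<And>n. a n + e n \<notin> C" by metis
    obtain r x u where r: "strict_mono r" "x \<in> K" "(X \<circ> r) \<longlonglongrightarrow> x" "u \<in> U x" "(a \<circ> r) \<longlonglongrightarrow> u" "norm u = 1"
      using U_unit_subseq[OF X] .
    have "e \<longlonglongrightarrow> 0"
      by (rule Lim_null_comparison[OF always_eventually LIMSEQ_inverse_real_of_nat]) (use small in blast)
    from tendsto_add[OF r(5) LIMSEQ_subseq_LIMSEQ[OF this r(1)]]
    have "(\<lambda>n. a (r n) + e (r n)) \<longlonglongrightarrow> u" by (simp add: o_def)
    moreover have "u \<in> interior C" using U_interior r by fastforce
    ultimately have "eventually (\<lambda>n. a (r n) + e (r n) \<in> interior C) sequentially"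
      by (rule topological_tendstoD[OF _ open_interior])
    then show False using out interior_subset by (auto simp: eventually_sequentially)
  qed
  then obtain \<delta> where \<delta>: "\<delta> > 0"
    "\<And>x u e. x \<in> K \<Longrightarrow> u \<in> U x \<Longrightarrow> norm u = 1 \<Longrightarrow> norm e \<le> \<delta> \<Longrightarrow> u + e \<in> C" by blast
  have "u + e \<in> C" if "x \<in> K" "u \<in> U x" "norm e \<le> \<delta> * norm u" "u \<noteq> 0" for x u e
  proof -
    have "u /\<^sub>R norm u + e /\<^sub>R norm u \<in> C"
      using that U_subspace by (intro \<delta>) (auto simp: subspace_scale field_simps)
    from C_scale[OF this, of "norm u"] show ?thesis using that by (simp add: algebra_simps)
  qed
  moreover have "0 + e \<in> C" if "norm e \<le> \<delta> * norm (0 :: 'a)" for e :: 'a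
    using that C_zero by simp
  ultimately show ?thesis using \<delta>(1) that by metis
qed

text \<open>The replacement for compactness of the unit sphere in \<open>W\<close>. An image \<open>T x w\<close> may be small, and
  then its direction is not controlled by the compactness of \<open>T x\<close>. But if the \<open>W\<close>-component
  of an orbit is at most \<open>R\<close> times the \<open>U\<close>-component and exceeds this ratio one step later,
  then its direction does lie in a fixed compact set. As \<open>R\<close> grows, vectors of the cone with that
  property approach unit vectors of \<open>W\<close> in the cone, and there are none. The scalar \<open>t\<close> leaves
  room for the gain factor used below.\<close>

lemma transverse_bound:
  obtains R where "R > 0"
    "\<And>x u w t. x \<in> K \<Longrightarrow> u \<in> U x \<Longrightarrow> w \<in> W x \<Longrightarrow> 0 \<le> t \<Longrightarrow> t \<le> 2 \<Longrightarrow> norm w \<le> R * norm u \<Longrightarrow>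
       T x u + t *\<^sub>R T x w \<in> C \<Longrightarrow> norm (t *\<^sub>R T x w) \<le> R * norm (T x u)"
proof (rule ccontr)
  assume "\<not> thesis"
  then have "\<exists>x u w t. x \<in> K \<and> u \<in> U x \<and> w \<in> W x \<and> 0 \<le> t \<and> t \<le> 2 \<and> norm w \<le> real (Suc n) * norm u \<and>
      T x u + t *\<^sub>R T x w \<in> C \<and> real (Suc n) * norm (T x u) < norm (t *\<^sub>R T x w)" for n
    using that[of "real (Suc n)"] by (metis not_le of_nat_0_less_iff zero_less_Suc)
  then obtain X a b t where X: "\<And>n. X n \<in> K" and a: "\<And>n. a n \<in> U (X n)" and b: "\<And>n. b n \<in> W (X n)"
    and t: "\<And>n. 0 \<le> t n" "\<And>n. t n \<le> 2" and ab: "\<And>n. norm (b n) \<le> real (Suc n) * norm (a n)"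
    and inC: "\<And>n. T (X n) (a n) + t n *\<^sub>R T (X n) (b n) \<in> C"
    and big: "\<And>n. real (Suc n) * norm (T (X n) (a n)) < norm (t n *\<^sub>R T (X n) (b n))" by metis
  obtain m where m: "m > 0" "\<And>x u. x \<in> K \<Longrightarrow> u \<in> U x \<Longrightarrow> m * norm u \<le> norm (T x u)"
    by (rule U_lower_bound) blast
  define \<tau> where "\<tau> n = norm (t n *\<^sub>R T (X n) (b n))" for n
  have big': "real (Suc n) * norm (T (X n) (a n)) < \<tau> n" for n using big by (simp add: \<tau>_def)
  have \<tau>: "\<tau> n > 0" for n
    using big'[of n] by (meson le_less_trans mult_nonneg_nonneg norm_ge_zero of_nat_0_le_iff)
  \<comment> \<open>Normalising by the image makes \<open>p\<close> vanish in the limit, while \<open>c\<close> stays bounded because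
    \<open>T\<close> is uniformly bounded below on \<open>U\<close>.\<close>
  define c where "c n = (t n / \<tau> n) *\<^sub>R b n" for n
  define p where "p n = T (X n) (a n) /\<^sub>R \<tau> n" for n
  have c_W: "c n \<in> W (X n)" for n using b X W_subspace by (auto simp: c_def subspace_scale)
  have Tc: "norm (T (X n) (c n)) = 1" for n
  proof -
    have "T (X n) (c n) = (t n *\<^sub>R T (X n) (b n)) /\<^sub>R \<tau> n"
      by (simp add: c_def blinfun.scaleR_right divide_inverse mult.commute)
    then have "norm (T (X n) (c n)) = inverse (\<tau> n) * \<tau> n"
      by (simp only: norm_scaleR[of "inverse (\<tau> n)"] \<tau>_def[symmetric]) (use \<tau>[of n] in simp)
    then show ?thesis using \<tau>[of n] by simp
  qed
  have c_bound: "norm (c n) \<le> 2 / m" for n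
  proof -
    have "norm (c n) = t n * norm (b n) / \<tau> n" using t(1)[of n] \<tau>[of n] by (simp add: c_def)
    also have "\<dots> \<le> 2 * (real (Suc n) * norm (a n)) / \<tau> n"
      using t \<tau>[of n] ab[of n] by (intro divide_right_mono mult_mono) auto
    also have "\<dots> \<le> 2 / m"
    proof -
      have "real (Suc n) * (m * norm (a n)) \<le> real (Suc n) * norm (T (X n) (a n))"
        using m(2) X a by (intro mult_left_mono) auto
      then have "real (Suc n) * (m * norm (a n)) \<le> \<tau> n" using big'[of n] by linarith
      then have "(2 * (real (Suc n) * norm (a n))) * m \<le> 2 * \<tau> n" by (simp add: algebra_simps)
      then show ?thesis by (subst frac_le_eq) (use m(1) \<tau>[of n] in \<open>auto simp: divide_simps mult_ac\<close>)
    qed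
    finally show ?thesis .
  qed
  have p_small: "norm (p n) \<le> inverse (real (Suc n))" for n
  proof -
    have "norm (p n) = norm (T (X n) (a n)) / \<tau> n" using \<tau>[of n] by (simp add: p_def divide_inverse mult.commute)
    also have "\<dots> \<le> 1 / real (Suc n)" using big'[of n] \<tau>[of n] by (simp add: divide_simps mult.commute del: of_nat_Suc)
    finally show ?thesis by (simp add: inverse_eq_divide)
  qed
  have pc: "p n + T (X n) (c n) \<in> C" for n
  proof -
    have "p n + T (X n) (c n) = inverse (\<tau> n) *\<^sub>R (T (X n) (a n) + t n *\<^sub>R T (X n) (b n))"
      by (simp add: p_def c_def blinfun.scaleR_right algebra_simps divide_inverse)
    then show ?thesis using C_scale[OF inC] by simp
  qed
  obtain r x where r: "strict_mono r" "x \<in> K" "(X \<circ> r) \<longlonglongrightarrow> x" using base_subseq[of X, OF X] .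
  obtain r' z where r': "strict_mono r'" "(\<lambda>n. T ((X \<circ> r) (r' n)) ((c \<circ> r) (r' n))) \<longlonglongrightarrow> z"
    using T_image_subseq[OF _ r(2,3), of "c \<circ> r" "2 / m"] X c_bound by auto
  have "norm z = 1" using tendsto_norm[OF r'(2)] Tc by (simp add: o_def LIMSEQ_const_iff)
  have "p \<longlonglongrightarrow> 0"
    by (rule Lim_null_comparison[OF always_eventually LIMSEQ_inverse_real_of_nat]) (use p_small in blast)
  from LIMSEQ_subseq_LIMSEQ[OF LIMSEQ_subseq_LIMSEQ[OF this r(1)] r'(1)]
  have "(\<lambda>n. p (r (r' n)) + T (X (r (r' n))) (c (r (r' n)))) \<longlonglongrightarrow> 0 + z"
    using r'(2) by (intro tendsto_add) (simp_all add: o_def)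
  then have "z \<in> C" using closed_sequentially[OF C_closed] pc by fastforce
  moreover have "z \<in> W (F x)"
  proof (rule closed_fibresD[OF W_closed, where X = "\<lambda>n. F (X (r (r' n)))"])
    show "(\<lambda>n. T (X (r (r' n))) (c (r (r' n)))) \<longlonglongrightarrow> z" using r'(2) by simp
    show "(\<lambda>n. F (X (r (r' n)))) \<longlonglongrightarrow> F x"
      using F_tendsto[of "X \<circ> r \<circ> r'" x] LIMSEQ_subseq_LIMSEQ[OF r(3) r'(1)] X r by simp
  qed (use X c_W W_invariant F_into r in auto)
  ultimately have "z = 0" using W_outside F_into r(2) by blast
  with \<open>norm z = 1\<close> show False by simp
qed

text \<open>One application of \<open>T\<close> turns a bounded sequence of \<open>W\<close>-components into a relatively compact
  one, but the limit is only known to be in the cone, not in its interior. The limit is nonzero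
  because \<open>U\<close> and \<open>W\<close> intersect trivially, so a second application moves it into the interior.\<close>

lemma two_step_margin:
  obtains \<rho> where "\<rho> > 0"
    "\<And>x u w e. x \<in> K \<Longrightarrow> u \<in> U x \<Longrightarrow> w \<in> W x \<Longrightarrow> norm w \<le> R * norm u \<Longrightarrow> u + w \<in> C \<Longrightarrow>
       norm e \<le> \<rho> * norm u \<Longrightarrow> T (F x) (T x (u + w)) + e \<in> C"
proof -
  have "\<exists>\<rho>>0. \<forall>x\<in>K. \<forall>u\<in>U x. \<forall>w\<in>W x. \<forall>e. norm u = 1 \<longrightarrow> norm w \<le> R \<longrightarrow> u + w \<in> C \<longrightarrow>
      norm e \<le> \<rho> \<longrightarrow> T (F x) (T x (u + w)) + e \<in> C"
  proof (rule ccontr)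
    assume "\<not> ?thesis"
    then have "\<exists>x u w e. x \<in> K \<and> u \<in> U x \<and> w \<in> W x \<and> norm u = 1 \<and> norm w \<le> R \<and> u + w \<in> C \<and>
        norm e \<le> inverse (real (Suc n)) \<and> T (F x) (T x (u + w)) + e \<notin> C" for n
      by (metis inverse_positive_iff_positive of_nat_0_less_iff zero_less_Suc)
    then obtain X a b e where X: "\<And>n. X n \<in> K" "\<And>n. a n \<in> U (X n)" "\<And>n. norm (a n) = 1"
      and b: "\<And>n. b n \<in> W (X n)" "\<And>n. norm (b n) \<le> R" and ab: "\<And>n. a n + b n \<in> C"
      and small: "\<And>n. norm (e n) \<le> inverse (real (Suc n))"
      and out: "\<And>n. T (F (X n)) (T (X n) (a n + b n)) + e n \<notin> C" by metis
    obtain r1 x u where r1: "strict_mono r1" "x \<in> K" "(X \<circ> r1) \<longlonglongrightarrow> x" "u \<in> U x" "(a \<circ> r1) \<longlonglongrightarrow> u" "norm u = 1"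
      using U_unit_subseq[OF X] .
    obtain r2 z where r2: "strict_mono r2" "(\<lambda>n. T ((X \<circ> r1) (r2 n)) ((b \<circ> r1) (r2 n))) \<longlonglongrightarrow> z"
      using T_image_subseq[OF _ r1(2,3), of "b \<circ> r1" R] X b by auto
    define r where "r = r1 \<circ> r2"
    have r: "strict_mono r" "(\<lambda>n. X (r n)) \<longlonglongrightarrow> x" "(\<lambda>n. a (r n)) \<longlonglongrightarrow> u"
      "(\<lambda>n. T (X (r n)) (b (r n))) \<longlonglongrightarrow> z"
      using strict_mono_o[OF r1(1) r2(1)] r2(2)
        LIMSEQ_subseq_LIMSEQ[OF r1(3) r2(1)] LIMSEQ_subseq_LIMSEQ[OF r1(5) r2(1)]
      by (simp_all add: r_def o_def)
    define y where "y n = T (X (r n)) (a (r n) + b (r n))" for n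
    have FX: "(\<lambda>n. F (X (r n))) \<longlonglongrightarrow> F x" using F_tendsto[OF _ r1(2) r(2)] X by simp
    have y_lim: "y \<longlonglongrightarrow> T x u + z"
      using tendsto_add[OF T_apply_tendsto[OF _ r1(2) r(2,3)] r(4)] X
      by (simp add: y_def[abs_def] blinfun.add_right)
    have "T x u + z \<in> C"
      using closed_sequentially[OF C_closed _ y_lim] C_image X ab by (simp add: y_def)
    moreover have "T x u + z \<noteq> 0"
    proof
      assume "T x u + z = 0"
      then have "T x u = - z" by (simp add: eq_neg_iff_add_eq_0)
      moreover have "z \<in> W (F x)"
        by (rule closed_fibresD[OF W_closed _ _ _ FX r(4)]) (use X b W_invariant F_into r1 in auto)
      ultimately have "T x u \<in> W (F x)" using W_subspace F_into r1(2) by (simp add: subspace_neg)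
      moreover have "T x u \<noteq> 0" using U_injective r1 by fastforce
      moreover have "T x u \<in> C"
        using U_interior[OF F_into[OF r1(2)] U_invariant[OF r1(2,4)]] \<open>T x u \<noteq> 0\<close> interior_subset by blast
      ultimately show False using W_outside F_into r1(2) by blast
    qed
    ultimately have "T (F x) (T x u + z) \<in> interior C" using C_invariant F_into r1(2) by blast
    moreover have "(\<lambda>n. T (F (X (r n))) (y n) + e (r n)) \<longlonglongrightarrow> T (F x) (T x u + z)"
    proof -
      have "e \<longlonglongrightarrow> 0"
        by (rule Lim_null_comparison[OF always_eventually LIMSEQ_inverse_real_of_nat]) (use small in blast)
      from tendsto_add[OF T_apply_tendsto[OF _ _ FX y_lim] LIMSEQ_subseq_LIMSEQ[OF this r(1)]]
      show ?thesis using X F_into r1(2) by (simp add: o_def)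
    qed
    ultimately have "eventually (\<lambda>n. T (F (X (r n))) (y n) + e (r n) \<in> interior C) sequentially"
      by (intro topological_tendstoD[OF _ open_interior])
    then show False using out interior_subset by (auto simp: eventually_sequentially y_def)
  qed
  then obtain \<rho> where \<rho>: "\<rho> > 0"
    "\<And>x u w e. x \<in> K \<Longrightarrow> u \<in> U x \<Longrightarrow> w \<in> W x \<Longrightarrow> norm u = 1 \<Longrightarrow> norm w \<le> R \<Longrightarrow> u + w \<in> C \<Longrightarrow>
       norm e \<le> \<rho> \<Longrightarrow> T (F x) (T x (u + w)) + e \<in> C" by metis
  have "T (F x) (T x (u + w)) + e \<in> C"
    if xu: "x \<in> K" "u \<in> U x" and w: "w \<in> W x" "norm w \<le> R * norm u" "u + w \<in> C" and e: "norm e \<le> \<rho> * norm u"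
    for x u w e
  proof (cases "u = 0")
    case True
    then show ?thesis using w e C_zero by simp
  next
    case False
    let ?s = "inverse (norm u)"
    have "T (F x) (T x (?s *\<^sub>R u + ?s *\<^sub>R w)) + ?s *\<^sub>R e \<in> C"
      using False xu w e U_subspace W_subspace C_scale[OF w(3), of ?s]
      by (intro \<rho>(2)) (auto simp: subspace_scale field_simps)
    from C_scale[OF this, of "norm u"] show ?thesis
      using False by (simp add: blinfun.bilinear_simps algebra_simps)
  qed
  with \<rho>(1) show ?thesis by (rule that)
qed

text \<open>The margin in the cone is spent on enlarging the \<open>W\<close>-component by a fixed factor. The enlarged
  vector is again in the cone, hence its component ratio is again at most \<open>R\<close> and the step can be
  iterated.\<close>

lemma two_step_gain:
  obtains R \<epsilon> where "R > 0" "\<epsilon> > 0"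
    "\<And>x u w. x \<in> K \<Longrightarrow> u \<in> U x \<Longrightarrow> w \<in> W x \<Longrightarrow> norm w \<le> R * norm u \<Longrightarrow> u + w \<in> C \<Longrightarrow>
       norm (T x w) \<le> R * norm (T x u)"
    "\<And>x u w. x \<in> K \<Longrightarrow> u \<in> U x \<Longrightarrow> w \<in> W x \<Longrightarrow> norm w \<le> R * norm u \<Longrightarrow> u + w \<in> C \<Longrightarrow>
       norm ((1 + \<epsilon>) *\<^sub>R T (F x) (T x w)) \<le> R * norm (T (F x) (T x u)) \<and>
       T (F x) (T x u) + (1 + \<epsilon>) *\<^sub>R T (F x) (T x w) \<in> C"
proof -
  obtain R where R: "R > 0" and bound:
    "\<And>x u w t. x \<in> K \<Longrightarrow> u \<in> U x \<Longrightarrow> w \<in> W x \<Longrightarrow> 0 \<le> t \<Longrightarrow> t \<le> 2 \<Longrightarrow> norm w \<le> R * norm u \<Longrightarrow>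
       T x u + t *\<^sub>R T x w \<in> C \<Longrightarrow> norm (t *\<^sub>R T x w) \<le> R * norm (T x u)"
    by (rule transverse_bound) blast
  obtain \<rho> where \<rho>: "\<rho> > 0" and margin:
    "\<And>x u w e. x \<in> K \<Longrightarrow> u \<in> U x \<Longrightarrow> w \<in> W x \<Longrightarrow> norm w \<le> R * norm u \<Longrightarrow> u + w \<in> C \<Longrightarrow>
       norm e \<le> \<rho> * norm u \<Longrightarrow> T (F x) (T x (u + w)) + e \<in> C"
    using two_step_margin[of R] by blast
  obtain A where A: "A > 0" "\<And>x. x \<in> K \<Longrightarrow> norm (T x) \<le> A" by (rule T_bounded) blast
  \<comment> \<open>At most 1, so that the scalar \<open>1 + \<epsilon>\<close> is admissible in \<open>bound\<close>.\<close>
  define \<epsilon> where "\<epsilon> = min 1 (\<rho> / (A * A * R))"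
  have \<epsilon>: "0 < \<epsilon>" "\<epsilon> \<le> 1" "\<epsilon> * (A * A * R) \<le> \<rho>"
    using \<rho> A(1) R by (auto simp: \<epsilon>_def min_def field_simps)
  have one: "norm (T x w) \<le> R * norm (T x u)"
    if "x \<in> K" "u \<in> U x" "w \<in> W x" "norm w \<le> R * norm u" "u + w \<in> C" for x u w
    using bound[of x u w 1] C_image[of x "u + w"] that by (simp add: blinfun.add_right)
  have two: "T (F x) (T x u) + (1 + \<epsilon>) *\<^sub>R T (F x) (T x w) \<in> C"
    if xuw: "x \<in> K" "u \<in> U x" "w \<in> W x" "norm w \<le> R * norm u" "u + w \<in> C" for x u w
  proof -
    have "norm (T (F x) (T x w)) \<le> norm (T (F x)) * (norm (T x) * norm w)"
      by (meson mult_left_mono norm_blinfun norm_ge_zero order_trans)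
    also have "\<dots> \<le> A * (A * (R * norm u))"
      using A F_into xuw R by (intro mult_mono) auto
    finally have "norm (\<epsilon> *\<^sub>R T (F x) (T x w)) \<le> \<epsilon> * (A * (A * (R * norm u)))"
      using \<epsilon>(1) by simp
    also have "\<dots> = (\<epsilon> * (A * A * R)) * norm u" by simp
    also have "\<dots> \<le> \<rho> * norm u" using \<epsilon>(3) by (intro mult_right_mono) auto
    finally have "T (F x) (T x (u + w)) + \<epsilon> *\<^sub>R T (F x) (T x w) \<in> C" using margin xuw by blast
    then show ?thesis by (simp add: blinfun.add_right algebra_simps)
  qed
  have "norm ((1 + \<epsilon>) *\<^sub>R T (F x) (T x w)) \<le> R * norm (T (F x) (T x u))"
    if xuw: "x \<in> K" "u \<in> U x" "w \<in> W x" "norm w \<le> R * norm u" "u + w \<in> C" for x u w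
    using xuw \<epsilon> by (intro bound one two F_into U_invariant W_invariant) auto
  then show ?thesis using that[OF R \<epsilon>(1)] one two by blast
qed

text \<open>Iterating the two-step gain along an orbit: the \<open>W\<close>-component, multiplied by \<open>(1 + \<epsilon>) ^ n\<close>, is
  still at most \<open>R\<close> times the \<open>U\<close>-component after \<open>2 * n\<close> steps. A small multiple of an
  arbitrary vector of \<open>W\<close> may serve as starting component because \<open>U\<close> is uniformly interior.\<close>

theorem exponential_separation: "\<exists>\<gamma>. exp_separated K F T \<gamma> U W"
proof -
  obtain R \<epsilon> where R: "R > 0" "\<epsilon> > 0"
    and one: "\<And>x u w. x \<in> K \<Longrightarrow> u \<in> U x \<Longrightarrow> w \<in> W x \<Longrightarrow> norm w \<le> R * norm u \<Longrightarrow> u + w \<in> C \<Longrightarrow>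
       norm (T x w) \<le> R * norm (T x u)"
    and two: "\<And>x u w. x \<in> K \<Longrightarrow> u \<in> U x \<Longrightarrow> w \<in> W x \<Longrightarrow> norm w \<le> R * norm u \<Longrightarrow> u + w \<in> C \<Longrightarrow>
       norm ((1 + \<epsilon>) *\<^sub>R T (F x) (T x w)) \<le> R * norm (T (F x) (T x u)) \<and>
       T (F x) (T x u) + (1 + \<epsilon>) *\<^sub>R T (F x) (T x w) \<in> C"
    by (rule two_step_gain) blast
  obtain \<delta> where \<delta>: "\<delta> > 0" "\<And>x u e. x \<in> K \<Longrightarrow> u \<in> U x \<Longrightarrow> norm e \<le> \<delta> * norm u \<Longrightarrow> u + e \<in> C"
    by (rule U_uniformly_interior) blast
  define \<eta> where "\<eta> = min \<delta> R"
  have \<eta>: "\<eta> > 0" "\<eta> \<le> \<delta>" "\<eta> \<le> R" using \<delta> R by (auto simp: \<eta>_def)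
  \<comment> \<open>The gain is \<open>1 + \<epsilon>\<close> per two steps; a last odd step costs the factor \<open>sqrt (1 + \<epsilon>)\<close>.\<close>
  define \<gamma> where "\<gamma> = 1 / sqrt (1 + \<epsilon>)"
  have \<gamma>: "0 < \<gamma>" "\<gamma> < 1" using R by (auto simp: \<gamma>_def)
  have even: "cocycle F T (2 * n) x u + (1 + \<epsilon>) ^ n *\<^sub>R cocycle F T (2 * n) x w \<in> C \<and>
      norm ((1 + \<epsilon>) ^ n *\<^sub>R cocycle F T (2 * n) x w) \<le> R * norm (cocycle F T (2 * n) x u)"
    if xuw: "x \<in> K" "u \<in> U x" "w \<in> W x" "norm w \<le> \<eta> * norm u" for x u w n
  proof (induction n)
    case 0
    have "norm w \<le> \<delta> * norm u" "norm w \<le> R * norm u"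
      using xuw(4) \<eta> by (meson mult_right_mono norm_ge_zero order_trans)+
    then show ?case using \<delta>(2) xuw by auto
  next
    case (Suc n)
    let ?x = "(F ^^ (2 * n)) x" and ?u = "cocycle F T (2 * n) x u"
    let ?w = "(1 + \<epsilon>) ^ n *\<^sub>R cocycle F T (2 * n) x w"
    have "?x \<in> K" "?u \<in> U ?x" "?w \<in> W ?x"
      using F_funpow_into cocycle_into[of U] cocycle_into[of W] U_invariant W_invariant W_subspace xuw
      by (auto intro!: subspace_scale)
    from two[OF this] Suc show ?case by (simp add: blinfun.scaleR_right mult_ac)
  qed
  have main: "norm (cocycle F T n x w) \<le> R * sqrt (1 + \<epsilon>) * \<gamma> ^ n * norm (cocycle F T n x u)"
    if xuw: "x \<in> K" "u \<in> U x" "w \<in> W x" "norm w \<le> \<eta> * norm u" for x u w n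
  proof -
    define k where "k = n div 2"
    have \<gamma>_even: "(1 + \<epsilon>) ^ k * \<gamma> ^ (2 * k) = 1"
      using R by (simp add: \<gamma>_def power_mult power_divide flip: power_mult_distrib)
    have key: "(1 + \<epsilon>) ^ k * norm (cocycle F T n x w) \<le> R * norm (cocycle F T n x u)"
    proof (cases "even n")
      case True
      then have "n = 2 * k" by (simp add: k_def)
      then show ?thesis using even[OF xuw, of k] R by simp
    next
      case False
      then have n: "n = Suc (2 * k)" by (auto simp: k_def)
      let ?x = "(F ^^ (2 * k)) x" and ?u = "cocycle F T (2 * k) x u"
      let ?w = "(1 + \<epsilon>) ^ k *\<^sub>R cocycle F T (2 * k) x w"
      have "?x \<in> K" "?u \<in> U ?x" "?w \<in> W ?x"
        using F_funpow_into cocycle_into[of U] cocycle_into[of W] U_invariant W_invariant W_subspace xuw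
        by (auto intro!: subspace_scale)
      from one[OF this] even[OF xuw, of k] show ?thesis using R by (simp add: n blinfun.scaleR_right)
    qed
    have "1 \<le> sqrt (1 + \<epsilon>) * \<gamma> ^ n * (1 + \<epsilon>) ^ k"
    proof (cases "even n")
      case True
      then have n: "n = 2 * k" by (simp add: k_def)
      have "sqrt (1 + \<epsilon>) * \<gamma> ^ n * (1 + \<epsilon>) ^ k = sqrt (1 + \<epsilon>) * ((1 + \<epsilon>) ^ k * \<gamma> ^ (2 * k))"
        unfolding n by simp
      also have "\<dots> = sqrt (1 + \<epsilon>)" using \<gamma>_even by simp
      finally have eq: "sqrt (1 + \<epsilon>) * \<gamma> ^ n * (1 + \<epsilon>) ^ k = sqrt (1 + \<epsilon>)" .
      show ?thesis unfolding eq using R by simp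
    next
      case False
      then have n: "n = Suc (2 * k)" by (auto simp: k_def)
      have "sqrt (1 + \<epsilon>) * \<gamma> ^ n * (1 + \<epsilon>) ^ k = (sqrt (1 + \<epsilon>) * \<gamma>) * ((1 + \<epsilon>) ^ k * \<gamma> ^ (2 * k))"
        unfolding n by simp
      also have "\<dots> = 1" using \<gamma>_even R by (simp add: \<gamma>_def)
      finally show ?thesis by simp
    qed
    then have "1 * norm (cocycle F T n x w) \<le> sqrt (1 + \<epsilon>) * \<gamma> ^ n * (1 + \<epsilon>) ^ k * norm (cocycle F T n x w)"
      by (intro mult_right_mono) auto
    also have "\<dots> = sqrt (1 + \<epsilon>) * \<gamma> ^ n * ((1 + \<epsilon>) ^ k * norm (cocycle F T n x w))" by simp
    also have "\<dots> \<le> sqrt (1 + \<epsilon>) * \<gamma> ^ n * (R * norm (cocycle F T n x u))"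
      using key \<gamma>(1) R by (intro mult_left_mono) auto
    finally show ?thesis by (simp add: mult_ac)
  qed
  have "norm (cocycle F T n x w) * norm u \<le>
      (R * sqrt (1 + \<epsilon>) / \<eta>) * \<gamma> ^ n * (norm (cocycle F T n x u) * norm w)"
    if xuw: "x \<in> K" "u \<in> U x" "w \<in> W x" for x u w n
  proof (cases "w = 0")
    case False
    define s where "s = \<eta> * norm u / norm w"
    have "s \<ge> 0" using \<eta> by (simp add: s_def)
    moreover have "norm (cocycle F T n x (s *\<^sub>R w)) \<le> R * sqrt (1 + \<epsilon>) * \<gamma> ^ n * norm (cocycle F T n x u)"
      using xuw W_subspace False \<eta>(1) by (intro main) (auto simp: subspace_scale s_def)
    ultimately have "s * norm (cocycle F T n x w) \<le> R * sqrt (1 + \<epsilon>) * \<gamma> ^ n * norm (cocycle F T n x u)"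
      by (simp add: blinfun.scaleR_right)
    then show ?thesis using False \<eta>(1) by (simp add: s_def field_simps)
  qed simp
  moreover have "R * sqrt (1 + \<epsilon>) / \<eta> > 0" using R \<eta> by simp
  ultimately show ?thesis using \<gamma> unfolding exp_separated_def by blast
qed

end

section \<open>Growth rates\<close>

lemma elog_mono: "0 \<le> a \<Longrightarrow> a \<le> b \<Longrightarrow> elog a \<le> elog b"
  by (auto simp: elog_def)

lemma elog_mult: "0 < c \<Longrightarrow> 0 \<le> a \<Longrightarrow> elog (c * a) = ereal (ln c) + elog a"
  by (auto simp: elog_def ln_mult)

lemma growth_rate_mono:
  assumes "eventually (\<lambda>n. 0 \<le> a n \<and> a n \<le> b n) sequentially"
  shows "growth_rate a \<le> growth_rate b"
  unfolding growth_rate_def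
proof (rule Limsup_mono)
  show "eventually (\<lambda>n. ereal (1 / real n) * elog (a n) \<le> ereal (1 / real n) * elog (b n)) sequentially"
    using assms by eventually_elim (intro ereal_mult_left_mono elog_mono, auto)
qed

text \<open>The identity holds term by term except at \<open>n = 0\<close>, where the factor \<open>1 / 0\<close> is zero; a vanishing
  \<open>a n\<close> contributes \<open>-\<infinity>\<close> to both sides.\<close>

lemma growth_rate_scale:
  assumes "c > 0" "\<gamma> > 0" "\<And>n. 0 \<le> a n"
  shows "growth_rate (\<lambda>n. c * \<gamma> ^ n * a n) = ereal (ln \<gamma>) + growth_rate a"
proof -
  have eq: "ereal (1 / real n) * elog (c * \<gamma> ^ n * a n) =
      ereal (ln c / real n + ln \<gamma>) + ereal (1 / real n) * elog (a n)" if "n > 0" for n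
  proof -
    have "elog (c * \<gamma> ^ n * a n) = ereal (ln c + real n * ln \<gamma>) + elog (a n)"
      using assms by (simp add: elog_mult ln_mult ln_realpow)
    then show ?thesis
      using that by (cases "a n = 0") (simp_all add: elog_def field_simps)
  qed
  have "growth_rate (\<lambda>n. c * \<gamma> ^ n * a n) =
      limsup (\<lambda>n. ereal (ln c / real n + ln \<gamma>) + ereal (1 / real n) * elog (a n))"
    unfolding growth_rate_def
    by (intro Limsup_eq eventually_mono[OF eventually_gt_at_top[of 0]] eq)
  also have "\<dots> = ereal (ln \<gamma>) + growth_rate a"
    unfolding growth_rate_def
  proof (rule ereal_limsup_lim_add)
    have "(\<lambda>n. ln c / real n + ln \<gamma>) \<longlonglongrightarrow> 0 + ln \<gamma>"
      by (intro tendsto_add lim_const_over_n tendsto_const)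
    then show "(\<lambda>n. ereal (ln c / real n + ln \<gamma>)) \<longlonglongrightarrow> ereal (ln \<gamma>)" by simp
  qed simp
  finally show ?thesis .
qed

lemma growth_rate_cmult: "c > 0 \<Longrightarrow> (\<And>n. 0 \<le> a n) \<Longrightarrow> growth_rate (\<lambda>n. c * a n) = growth_rate a"
  using growth_rate_scale[of c 1 a] by (simp add: zero_ereal_def[symmetric])

text \<open>A perturbation of relatively vanishing size changes norms by a factor that is eventually between
  \<open>1/2\<close> and \<open>2\<close>, and constant factors do not affect the rate.\<close>

lemma growth_rate_perturb:
  fixes a b :: "nat \<Rightarrow> 'a::real_normed_vector"
  assumes nz: "\<And>n. a n \<noteq> 0" and lim: "(\<lambda>n. norm (b n) / norm (a n)) \<longlonglongrightarrow> 0"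
  shows "growth_rate (\<lambda>n. norm (a n + b n)) = growth_rate (\<lambda>n. norm (a n))"
proof -
  have ev: "eventually (\<lambda>n. norm (b n) \<le> norm (a n) / 2) sequentially"
    using order_tendstoD(2)[OF lim, of "1/2"]
    by (auto elim!: eventually_mono simp: nz divide_less_eq)
  have "growth_rate (\<lambda>n. norm (a n + b n)) \<le> growth_rate (\<lambda>n. 2 * norm (a n))"
  proof (rule growth_rate_mono, use ev in eventually_elim)
    case (elim n)
    then show ?case using norm_triangle_ineq[of "a n" "b n"] norm_ge_zero[of "b n"]
      by (intro conjI norm_ge_zero) linarith
  qed
  moreover have "growth_rate (\<lambda>n. (1/2) * norm (a n)) \<le> growth_rate (\<lambda>n. norm (a n + b n))"
  proof (rule growth_rate_mono, use ev in eventually_elim)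
    case (elim n)
    then show ?case using norm_diff_ineq[of "a n" "b n"] by simp
  qed
  ultimately show ?thesis by (simp add: growth_rate_cmult del: times_divide_eq_left)
qed

lemma min_stretch_le: "v \<in> V \<Longrightarrow> norm v = 1 \<Longrightarrow> min_stretch A V \<le> norm (blinfun_apply A v)"
  unfolding min_stretch_def by (rule cINF_lower) (auto intro: bdd_belowI2[of _ 0])

lemma min_stretch_greatest:
  "V \<inter> sphere 0 1 \<noteq> {} \<Longrightarrow> (\<And>v. v \<in> V \<Longrightarrow> norm v = 1 \<Longrightarrow> c \<le> norm (blinfun_apply A v)) \<Longrightarrow> c \<le> min_stretch A V"
  unfolding min_stretch_def by (rule cINF_greatest) auto

lemma min_stretch_nonneg: "V \<inter> sphere 0 1 \<noteq> {} \<Longrightarrow> 0 \<le> min_stretch A V"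
  by (rule min_stretch_greatest) auto

lemma min_stretch_antimono: "V \<inter> sphere 0 1 \<noteq> {} \<Longrightarrow> V \<subseteq> V' \<Longrightarrow> min_stretch A V' \<le> min_stretch A V"
  by (rule min_stretch_greatest) (auto intro: min_stretch_le)

lemma min_stretch_mult_le:
  assumes "subspace V" "v \<in> V"
  shows "min_stretch A V * norm v \<le> norm (blinfun_apply A v)"
proof (cases "v = 0")
  case False
  then have "min_stretch A V \<le> norm (blinfun_apply A (v /\<^sub>R norm v))"
    using assms by (intro min_stretch_le) (auto simp: subspace_scale)
  then show ?thesis using False by (simp add: blinfun.scaleR_right field_simps)
qed simp

lemma exp_separated_min_stretch:
  assumes sep: "exp_separated K F T \<gamma> U W" and x: "x \<in> K"
    and U: "U x \<inter> sphere 0 1 \<noteq> {}" and W: "W x \<inter> sphere 0 1 \<noteq> {}"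
  obtains M where "M > 0"
    "\<And>n. min_stretch (cocycle F T n x) (W x) \<le> M * \<gamma> ^ n * min_stretch (cocycle F T n x) (U x)"
proof -
  obtain M where M: "M > 0" "\<And>u w n. u \<in> U x \<Longrightarrow> w \<in> W x \<Longrightarrow>
      norm (cocycle F T n x w) * norm u \<le> M * \<gamma> ^ n * (norm (cocycle F T n x u) * norm w)"
    using sep x unfolding exp_separated_def by blast
  have \<gamma>: "\<gamma> > 0" using sep by (simp add: exp_separated_def)
  obtain w where w: "w \<in> W x" "norm w = 1" using W by auto
  have "min_stretch (cocycle F T n x) (W x) / (M * \<gamma> ^ n) \<le> min_stretch (cocycle F T n x) (U x)" for n
  proof (rule min_stretch_greatest[OF U])
    fix u assume u: "u \<in> U x" "norm u = 1"
    have "min_stretch (cocycle F T n x) (W x) \<le> M * \<gamma> ^ n * norm (cocycle F T n x u)"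
      using min_stretch_le[OF w, of "cocycle F T n x"] M(2)[OF u(1) w(1), of n] u w by simp
    then show "min_stretch (cocycle F T n x) (W x) / (M * \<gamma> ^ n) \<le> norm (cocycle F T n x u)"
      using M(1) \<gamma> by (simp add: pos_divide_le_eq mult_ac)
  qed
  then show ?thesis using M(1) \<gamma> by (intro that[of M]) (simp_all add: pos_divide_le_eq mult_ac)
qed

section \<open>Direct sums\<close>

lemma subspace_set_plus:
  fixes A B :: "'a::real_vector set"
  shows "subspace A \<Longrightarrow> subspace B \<Longrightarrow> subspace (A + B)"
  unfolding set_plus_def using subspace_sums[of A B] by (simp add: Bex_def conj_ac)

text \<open>A kernel vector extends to a basis of \<open>H\<close>, whose remaining members would already span the image.\<close>

lemma surjective_imp_injective_G:
  fixes A :: "'a::real_vector \<Rightarrow> 'b::real_vector"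
  assumes A: "linear A" "A ` H = H'" and H: "H \<in> G d" "H' \<in> G d" and v: "v \<in> H" "A v = 0"
  shows "v = 0"
proof (rule ccontr)
  assume "v \<noteq> 0"
  then have "independent {v}" by simp
  then obtain B where B: "{v} \<subseteq> B" "B \<subseteq> H" "independent B" "H \<subseteq> span B"
    using maximal_independent_subset_extend[of "{v}" H] v by auto
  obtain S where S: "finite S" "span S = H" using H(1) by (auto simp: G_def finite_dim_def)
  have fin: "finite B" using independent_span_bound[of S B] B S by auto
  have card: "card B = d" using basis_card_eq_dim[OF B(2,4,3)] H by (auto simp: G_def)
  have "H' \<subseteq> span (A ` B)" using A B(4) linear_span_image by blast
  also have "\<dots> \<subseteq> span (insert 0 (A ` (B - {v})))" using v by (intro span_mono) auto
  finally have "H' \<subseteq> span (A ` (B - {v}))" by simp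
  then have "dim H' \<le> card (A ` (B - {v}))" using fin by (intro dim_le_card) auto
  also have "\<dots> \<le> card (B - {v})" using fin by (intro card_image_le) auto
  also have "\<dots> < card B" using B fin by (intro psubset_card_mono) auto
  finally show False using card H by (simp add: G_def)
qed

lemma decomposesE:
  assumes "decomposes N P Q"
  obtains p q where "\<And>l. l \<le> N \<Longrightarrow> p l \<in> P l" "q \<in> Q" "v = (\<Sum>l\<le>N. p l) + q"
proof -
  have "v \<in> (\<Sum>i\<le>N. P i) + Q" using assms by (simp add: decomposes_def)
  then show ?thesis using that by (auto simp: set_sum_alt elim!: set_plus_elim)
qed

lemma decomposes_unique:
  assumes "decomposes N P Q" "\<And>l. l \<le> N \<Longrightarrow> subspace (P l)" "subspace Q"
    "\<And>l. l \<le> N \<Longrightarrow> p l \<in> P l" "\<And>l. l \<le> N \<Longrightarrow> p' l \<in> P l" "q \<in> Q" "q' \<in> Q"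
    "(\<Sum>l\<le>N. p l) + q = (\<Sum>l\<le>N. p' l) + q'" "i \<le> N"
  shows "p i = p' i"
proof -
  have "(\<Sum>l\<le>N. p l - p' l) + (q - q') = 0" using assms(8) by (simp add: sum_subtractf algebra_simps)
  moreover have "\<forall>l\<le>N. p l - p' l \<in> P l" "q - q' \<in> Q" using assms by (auto simp: subspace_diff)
  ultimately have *: "(\<forall>l\<le>N. p l - p' l \<in> P l) \<and> q - q' \<in> Q \<and> (\<Sum>l\<le>N. p l - p' l) + (q - q') = 0"
    by blast
  have "\<forall>p q. (\<forall>i\<le>N. p i \<in> P i) \<and> q \<in> Q \<and> (\<Sum>i\<le>N. p i) + q = 0 \<longrightarrow> (\<forall>i\<le>N. p i = 0) \<and> q = 0"
    using assms(1) unfolding decomposes_def by (rule conjunct2)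
  then have "(\<forall>i\<le>N. p i - p' i = 0) \<and> q - q' = 0" using * by (elim allE[of _ "\<lambda>l. p l - p' l"]) blast
  then have "p i - p' i = 0" using assms(9) by blast
  then show ?thesis by simp
qed

lemma SP_0: "SP P 0 x = P 0 x"
  by (simp add: SP_def)

lemma SP_Suc: "SP P (Suc i) x = SP P i x + P (Suc i) x"
  by (simp add: SP_def)

lemma Q_minus_eq:
  assumes "i \<le> N"
  shows "Q_minus N P Q i x = (\<Sum>l\<in>{..N} - {i}. P l x) + Q x"
proof (cases i)
  case 0
  then have "{..N} - {i} = {0<..N}" by auto
  then show ?thesis using 0 by (simp add: Q_minus_def Q_tail_def)
next
  case (Suc m)
  then have "{..N} - {i} = {..m} \<union> {Suc m<..N}" using assms by auto
  moreover have "(\<Sum>l\<in>{..m} \<union> {Suc m<..N}. P l x) = (\<Sum>l\<le>m. P l x) + (\<Sum>l\<in>{Suc m<..N}. P l x)"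
    by (rule sum.union_disjoint) auto
  ultimately show ?thesis using Suc by (simp add: Q_minus_def Q_tail_def SP_def add.assoc)
qed

text \<open>The complement in the definition of the projection is the sum of all other summands, so the
  projection is the component in the decomposition.\<close>

lemma Proj_eq:
  fixes P :: "nat \<Rightarrow> 'x \<Rightarrow> 'a::real_vector set"
  assumes dec: "decomposes N (\<lambda>i. P i x) (Q x)" "\<And>l. l \<le> N \<Longrightarrow> subspace (P l x)" "subspace (Q x)"
    and pq: "\<And>l. l \<le> N \<Longrightarrow> p l \<in> P l x" "q \<in> Q x" "v = (\<Sum>l\<le>N. p l) + q" and i: "i \<le> N"
  shows "Proj N P Q i x v = p i"
  unfolding Proj_def proj_along_def
proof (rule the_equality)
  have split: "(\<Sum>l\<le>N. f l) = f i + (\<Sum>l\<in>{..N} - {i}. f l)" for f :: "nat \<Rightarrow> 'a"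
    using i by (simp add: sum.remove)
  have "v - p i = (\<Sum>l\<in>{..N} - {i}. p l) + q" using pq(3) split[of p] by simp
  moreover have "(\<Sum>l\<in>{..N} - {i}. p l) \<in> (\<Sum>l\<in>{..N} - {i}. P l x)"
    using pq(1) by (auto simp: set_sum_alt)
  ultimately have "v - p i \<in> Q_minus N P Q i x"
    unfolding Q_minus_eq[OF i] using pq(2) by (metis set_plus_intro)
  then show "p i \<in> P i x \<and> v - p i \<in> Q_minus N P Q i x" using pq(1) i by blast
next
  fix p' assume p': "p' \<in> P i x \<and> v - p' \<in> Q_minus N P Q i x"
  then obtain s q' where s: "\<And>l. l \<in> {..N} - {i} \<Longrightarrow> s l \<in> P l x" and q': "q' \<in> Q x"
    and eq: "v - p' = (\<Sum>l\<in>{..N} - {i}. s l) + q'"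
    using i by (auto simp: Q_minus_eq set_sum_alt elim!: set_plus_elim)
  have "(\<Sum>l\<le>N. (s(i := p')) l) = p' + (\<Sum>l\<in>{..N} - {i}. s l)"
    using i by (subst sum.remove[of _ i]) (auto intro!: sum.cong)
  then have "(\<Sum>l\<le>N. (s(i := p')) l) + q' = (\<Sum>l\<le>N. p l) + q"
    using eq pq(3) by (simp add: algebra_simps)
  from decomposes_unique[OF dec _ _ q' pq(2) this i] have "(s(i := p')) i = p i"
    using s p' pq(1) by auto
  then show "p' = p i" by simp
qed

lemma decomposes_SP_disjoint:
  assumes dec: "decomposes N (\<lambda>i. P i x) (Q x)" "\<And>l. l \<le> N \<Longrightarrow> subspace (P l x)" "subspace (Q x)"
    and i: "i < N"
  shows "SP P i x \<inter> P (Suc i) x \<subseteq> {0}"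
proof
  fix v assume v: "v \<in> SP P i x \<inter> P (Suc i) x"
  then obtain s where s: "\<And>l. l \<le> i \<Longrightarrow> s l \<in> P l x" "v = (\<Sum>l\<le>i. s l)"
    by (auto simp: SP_def set_sum_alt)
  define s' where "s' l = (if l \<le> i then s l else 0)" for l
  define v' where "v' l = (if l = Suc i then v else 0)" for l
  have "(\<Sum>l\<le>N. s' l) = (\<Sum>l\<le>i. s l)"
    using i by (intro sum.mono_neutral_cong_right) (auto simp: s'_def)
  moreover have "(\<Sum>l\<le>N. v' l) = v" using i by (simp add: v'_def)
  ultimately have "(\<Sum>l\<le>N. s' l) + 0 = (\<Sum>l\<le>N. v' l) + 0" using s(2) by simp
  moreover have "s' l \<in> P l x" "v' l \<in> P l x" if "l \<le> N" for l
    using s(1) v dec(2)[OF that] by (auto simp: s'_def v'_def subspace_0)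
  ultimately have "s' (Suc i) = v' (Suc i)"
    using decomposes_unique[OF dec, of s' v' 0 0 "Suc i"] i dec(3) by (simp add: subspace_0)
  then have "0 = v" by (simp add: s'_def v'_def)
  then show "v \<in> {0}" by simp
qed

section \<open>Exponents of a decomposition ordered by cones\<close>

text \<open>The cone \<open>C i\<close> separates the summand \<open>P i\<close> from its successor, which is \<open>Q\<close> for the last index.
  Comparisons between distant summands come from transitivity of separation.\<close>

locale cone_decomposition = compact_cocycle K F T
  for K :: "'x::metric_space set" and F :: "'x \<Rightarrow> 'x" and T :: "'x \<Rightarrow> 'a::real_normed_vector \<Rightarrow>\<^sub>L 'a" +
  fixes N :: nat and d :: "nat \<Rightarrow> nat" and c :: nat and C :: "nat \<Rightarrow> 'a set"
    and P :: "nat \<Rightarrow> 'x \<Rightarrow> 'a set" and Q :: "'x \<Rightarrow> 'a set"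
  assumes P_bundle: "i \<le> N \<Longrightarrow> dim_bundle K (d i) (P i)" and d_pos: "i \<le> N \<Longrightarrow> d i > 0"
    and Q_bundle: "codim_bundle K c Q" and c_pos: "c > 0"
    and decomposition: "invariant_decomposition K F T N P Q"
    and C_closed: "i \<le> N \<Longrightarrow> closed (C i)"
    and C_zero: "i \<le> N \<Longrightarrow> 0 \<in> C i"
    and C_scale: "i \<le> N \<Longrightarrow> v \<in> C i \<Longrightarrow> r *\<^sub>R v \<in> C i"
    and C_invariant: "i \<le> N \<Longrightarrow> x \<in> K \<Longrightarrow> v \<in> C i \<Longrightarrow> v \<noteq> 0 \<Longrightarrow> T x v \<in> interior (C i)"
    and P_interior: "i \<le> N \<Longrightarrow> x \<in> K \<Longrightarrow> v \<in> P i x \<Longrightarrow> v \<noteq> 0 \<Longrightarrow> v \<in> interior (C i)"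
    and P_outside: "i < N \<Longrightarrow> x \<in> K \<Longrightarrow> v \<in> P (Suc i) x \<Longrightarrow> v \<in> C i \<Longrightarrow> v = 0"
    and Q_outside: "x \<in> K \<Longrightarrow> v \<in> Q x \<Longrightarrow> v \<in> C N \<Longrightarrow> v = 0"
begin

lemma P_G: "i \<le> N \<Longrightarrow> x \<in> K \<Longrightarrow> P i x \<in> G (d i)"
  using P_bundle by (auto simp: dim_bundle_def)

lemma P_subspace: "i \<le> N \<Longrightarrow> x \<in> K \<Longrightarrow> subspace (P i x)"
  using P_G by (auto simp: G_def finite_dim_def)

lemma P_compact: "i \<le> N \<Longrightarrow> compact_fibres K (P i)"
  using dim_bundle_compact_fibres P_bundle d_pos by blast

lemma P_sphere: "i \<le> N \<Longrightarrow> x \<in> K \<Longrightarrow> P i x \<inter> sphere 0 1 \<noteq> {}"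
  using dim_bundle_sphere_nonempty P_bundle d_pos by blast

lemma P_nontrivial: "i \<le> N \<Longrightarrow> x \<in> K \<Longrightarrow> \<exists>v\<in>P i x. v \<noteq> 0"
  using P_sphere by fastforce

lemma P_image: "i \<le> N \<Longrightarrow> x \<in> K \<Longrightarrow> T x ` P i x = P i (F x)"
  using decomposition by (simp add: invariant_decomposition_def)

lemma P_invariant: "i \<le> N \<Longrightarrow> x \<in> K \<Longrightarrow> v \<in> P i x \<Longrightarrow> T x v \<in> P i (F x)"
  using P_image by blast

text \<open>By \<open>P_image\<close> the operator is onto between spaces of equal finite dimension.\<close>

lemma P_injective: "i \<le> N \<Longrightarrow> x \<in> K \<Longrightarrow> v \<in> P i x \<Longrightarrow> T x v = 0 \<Longrightarrow> v = 0"
  by (rule surjective_imp_injective_G[OF bounded_linear.linear[OF blinfun.bounded_linear_right] P_image P_G P_G])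
    (auto intro: F_into)

lemma Q_subspace: "x \<in> K \<Longrightarrow> subspace (Q x)"
  using Q_bundle by (auto simp: codim_bundle_def closed_codim_def)

lemma Q_invariant: "x \<in> K \<Longrightarrow> v \<in> Q x \<Longrightarrow> T x v \<in> Q (F x)"
  using decomposition unfolding invariant_decomposition_def by blast

lemma decomposes_at: "x \<in> K \<Longrightarrow> decomposes N (\<lambda>i. P i x) (Q x)"
  using decomposition by (simp add: invariant_decomposition_def)

lemma consecutive_separated:
  assumes "i < N"
  shows "\<exists>\<gamma>. exp_separated K F T \<gamma> (P i) (P (Suc i))"
proof -
  have i: "i \<le> N" "Suc i \<le> N" using assms by auto
  interpret cone_separation K F T "C i" "P i" "P (Suc i)"
    by unfold_locales
      (fact C_closed[OF i(1)] C_zero[OF i(1)] C_scale[OF i(1)] C_invariant[OF i(1)]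
        P_subspace[OF i(1)] P_compact[OF i(1)] P_interior[OF i(1)] P_invariant[OF i(1)]
        P_injective[OF i(1)] P_subspace[OF i(2)] compact_imp_closed_fibres[OF P_compact[OF i(2)]]
        P_outside[OF assms] P_invariant[OF i(2)])+
  show ?thesis by (rule exponential_separation)
qed

lemma last_separated: "\<exists>\<gamma>. exp_separated K F T \<gamma> (P N) Q"
proof -
  interpret cone_separation K F T "C N" "P N" Q
    by unfold_locales
      (fact C_closed[OF order_refl] C_zero[OF order_refl] C_scale[OF order_refl] C_invariant[OF order_refl]
        P_subspace[OF order_refl] P_compact[OF order_refl] P_interior[OF order_refl]
        P_invariant[OF order_refl] P_injective[OF order_refl] Q_subspace
        codim_bundle_closed_fibres[OF Q_bundle c_pos] Q_outside Q_invariant)+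
  show ?thesis by (rule exponential_separation)
qed

lemma separated:
  assumes "i < l" "l \<le> N"
  shows "\<exists>\<gamma>. exp_separated K F T \<gamma> (P i) (P l)"
  using assms
proof (induction l)
  case (Suc l)
  show ?case
  proof (cases "i = l")
    case True
    then show ?thesis using consecutive_separated Suc by auto
  next
    case False
    then obtain \<gamma> \<gamma>' where "exp_separated K F T \<gamma> (P i) (P l)" "exp_separated K F T \<gamma>' (P l) (P (Suc l))"
      using Suc consecutive_separated[of l] by auto
    from exp_separated_trans[OF this P_nontrivial] show ?thesis using Suc by auto
  qed
qed simp

lemma separated_Q:
  assumes "i \<le> N"
  shows "\<exists>\<gamma>. exp_separated K F T \<gamma> (P i) Q"
proof (cases "i = N")
  case False
  then obtain \<gamma> \<gamma>' where "exp_separated K F T \<gamma> (P i) (P N)" "exp_separated K F T \<gamma>' (P N) Q"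
    using assms separated[of i N] last_separated by auto
  from exp_separated_trans[OF this P_nontrivial] show ?thesis by auto
qed (use last_separated in simp)

lemma SP_subspace: "i \<le> N \<Longrightarrow> x \<in> K \<Longrightarrow> subspace (SP P i x)"
  by (induction i) (auto simp: SP_0 SP_Suc intro!: subspace_set_plus P_subspace)

lemma SP_P_disjoint: "i < N \<Longrightarrow> x \<in> K \<Longrightarrow> SP P i x \<inter> P (Suc i) x \<subseteq> {0}"
  using decomposes_SP_disjoint[of N P x Q i] decomposes_at P_subspace Q_subspace by blast

lemma SP_compact: "i \<le> N \<Longrightarrow> compact_fibres K (SP P i)"
proof (induction i)
  case 0
  moreover have "SP P 0 = P 0" by (simp add: SP_0 fun_eq_iff)
  ultimately show ?case using P_compact[of 0] by simp
next
  case (Suc i)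
  then have "compact_fibres K (\<lambda>x. SP P i x + P (Suc i) x)"
    by (intro compact_fibres_plus compact_base P_compact SP_subspace P_subspace SP_P_disjoint) auto
  moreover have "SP P (Suc i) = (\<lambda>x. SP P i x + P (Suc i) x)" by (simp add: SP_Suc fun_eq_iff)
  ultimately show ?case by simp
qed

lemma SP_invariant: "i \<le> N \<Longrightarrow> x \<in> K \<Longrightarrow> v \<in> SP P i x \<Longrightarrow> T x v \<in> SP P i (F x)"
proof (induction i arbitrary: v)
  case (Suc i)
  from Suc.prems(3) obtain a b where ab: "v = a + b" "a \<in> SP P i x" "b \<in> P (Suc i) x"
    unfolding SP_Suc by (rule set_plus_elim)
  have "T x a \<in> SP P i (F x)" "T x b \<in> P (Suc i) (F x)"
    using Suc ab P_invariant[of "Suc i"] by auto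
  then show ?case unfolding SP_Suc ab(1) blinfun.add_right by (rule set_plus_intro)
qed (simp add: SP_0 P_invariant)

lemma P_subset_SP: "i \<le> N \<Longrightarrow> x \<in> K \<Longrightarrow> P i x \<subseteq> SP P i x"
proof (cases i)
  case (Suc m)
  assume "i \<le> N" "x \<in> K"
  then have "0 \<in> SP P m x" using SP_subspace[of m x] Suc by (simp add: subspace_0)
  then show ?thesis by (auto simp: Suc SP_Suc intro: set_zero_plus2[THEN subsetD])
qed (simp add: SP_0)

text \<open>The least stretched summand of the partial sum is, up to a constant, the last one. The summands
  stay at a positive angle along the whole orbit, so a vector of the sum is stretched at least like
  its components, and the components in earlier summands are stretched more by separation.\<close>

lemma SP_stretch_lower:
  assumes "i \<le> N" "x \<in> K"
  shows "\<exists>a>0. \<forall>n. a * min_stretch (cocycle F T n x) (P i x) \<le> min_stretch (cocycle F T n x) (SP P i x)"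
  using assms(1)
proof (induction i)
  case 0
  show ?case by (rule exI[of _ 1]) (simp add: SP_0)
next
  case (Suc i)
  note x = assms(2)
  let ?m = "\<lambda>n V. min_stretch (cocycle F T n x) V"
  obtain a where a: "a > 0" "\<And>n. a * ?m n (P i x) \<le> ?m n (SP P i x)" using Suc by auto
  obtain \<gamma> where \<gamma>: "exp_separated K F T \<gamma> (P i) (P (Suc i))"
    using consecutive_separated[of i] Suc by auto
  obtain M where M: "M > 0" "\<And>n. ?m n (P (Suc i) x) \<le> M * \<gamma> ^ n * ?m n (P i x)"
    using exp_separated_min_stretch[OF \<gamma> x P_sphere P_sphere] Suc x by auto
  have MP: "?m n (P (Suc i) x) \<le> M * ?m n (P i x)" for n
  proof -
    have "M * \<gamma> ^ n * ?m n (P i x) \<le> M * 1 * ?m n (P i x)"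
      using M(1) \<gamma> min_stretch_nonneg[OF P_sphere[of i x]] Suc x
      by (intro mult_right_mono mult_left_mono power_le_one) (auto simp: exp_separated_def)
    then show ?thesis using M(2)[of n] by simp
  qed
  have hyps: "compact_fibres K (SP P i)" "compact_fibres K (P (Suc i))"
    "\<And>x. x \<in> K \<Longrightarrow> subspace (SP P i x)" "\<And>x. x \<in> K \<Longrightarrow> subspace (P (Suc i) x)"
    "\<And>x. x \<in> K \<Longrightarrow> SP P i x \<inter> P (Suc i) x \<subseteq> {0}"
    using SP_compact P_compact SP_subspace P_subspace SP_P_disjoint Suc by auto
  obtain \<kappa>1 where \<kappa>1: "\<kappa>1 > 0"
    "\<And>x p q. x \<in> K \<Longrightarrow> p \<in> SP P i x \<Longrightarrow> q \<in> P (Suc i) x \<Longrightarrow> \<kappa>1 * norm p \<le> norm (p + q)"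
    using uniform_angle[OF compact_base hyps(1,3,2,4,5)] by blast
  obtain \<kappa>2 where \<kappa>2: "\<kappa>2 > 0"
    "\<And>x p q. x \<in> K \<Longrightarrow> q \<in> P (Suc i) x \<Longrightarrow> p \<in> SP P i x \<Longrightarrow> \<kappa>2 * norm q \<le> norm (q + p)"
    using uniform_angle[OF compact_base hyps(2,4,1,3)] hyps(5) by (metis Int_commute)
  define e where "e = min (\<kappa>1 * a / M) \<kappa>2"
  have e: "e > 0" "e \<le> \<kappa>1 * a / M" "e \<le> \<kappa>2" using \<kappa>1(1) \<kappa>2(1) a(1) M(1) by (auto simp: e_def)
  have "e / 2 * ?m n (P (Suc i) x) \<le> ?m n (SP P (Suc i) x)" for n
  proof (rule min_stretch_greatest)
    show "SP P (Suc i) x \<inter> sphere 0 1 \<noteq> {}" using P_subset_SP[of "Suc i" x] P_sphere[of "Suc i" x] Suc x by blast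
  next
    fix v assume v: "v \<in> SP P (Suc i) x" "norm v = 1"
    then obtain p q where pq: "p \<in> SP P i x" "q \<in> P (Suc i) x" "v = p + q"
      by (auto simp: SP_Suc elim!: set_plus_elim)
    let ?A = "cocycle F T n x" and ?y = "(F ^^ n) x"
    have i: "i \<le> N" "Suc i \<le> N" using Suc by auto
    have "?A p \<in> SP P i ?y"
      using SP_invariant[OF i(1)] x pq(1) by (rule cocycle_into)
    moreover have "?A q \<in> P (Suc i) ?y"
      using P_invariant[OF i(2)] x pq(2) by (rule cocycle_into)
    ultimately have into: "?y \<in> K" "?A p \<in> SP P i ?y" "?A q \<in> P (Suc i) ?y"
      using F_funpow_into[OF x] by blast+
    have nonneg: "0 \<le> ?m n (P (Suc i) x)" by (rule min_stretch_nonneg[OF P_sphere[OF i(2) x]])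
    have "e * ?m n (P (Suc i) x) \<le> \<kappa>1 * a / M * (M * ?m n (P i x))"
      using e MP[of n] nonneg by (intro mult_mono) auto
    also have "\<dots> = \<kappa>1 * (a * ?m n (P i x))" using M(1) by simp
    also have "\<dots> \<le> \<kappa>1 * ?m n (SP P i x)" using a(2) \<kappa>1(1) by (intro mult_left_mono) auto
    finally have "e * ?m n (P (Suc i) x) * norm p \<le> \<kappa>1 * ?m n (SP P i x) * norm p"
      by (rule mult_right_mono) simp
    also have "\<dots> = \<kappa>1 * (?m n (SP P i x) * norm p)" by simp
    also have "\<dots> \<le> \<kappa>1 * norm (?A p)"
      using \<kappa>1(1) pq x Suc by (intro mult_left_mono min_stretch_mult_le SP_subspace) auto
    also have "\<dots> \<le> norm (?A v)" using \<kappa>1(2)[OF into] by (simp add: pq blinfun.add_right)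
    finally have 1: "e * ?m n (P (Suc i) x) * norm p \<le> norm (?A v)" .
    have "e * ?m n (P (Suc i) x) * norm q \<le> \<kappa>2 * ?m n (P (Suc i) x) * norm q"
      using e nonneg by (intro mult_right_mono) auto
    also have "\<dots> = \<kappa>2 * (?m n (P (Suc i) x) * norm q)" by simp
    also have "\<dots> \<le> \<kappa>2 * norm (?A q)"
      using \<kappa>2(1) pq x Suc by (intro mult_left_mono min_stretch_mult_le P_subspace) auto
    also have "\<dots> \<le> norm (?A v)"
      using \<kappa>2(2)[OF into(1,3,2)] by (simp add: pq blinfun.add_right add.commute)
    finally have 2: "e * ?m n (P (Suc i) x) * norm q \<le> norm (?A v)" .
    have "1 \<le> norm p + norm q" using v pq norm_triangle_ineq[of p q] by simp
    then have "e * ?m n (P (Suc i) x) * 1 \<le> e * ?m n (P (Suc i) x) * (norm p + norm q)"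
      using e nonneg by (intro mult_left_mono) auto
    also have "\<dots> \<le> 2 * norm (?A v)" using 1 2 by (simp add: distrib_left)
    finally show "e / 2 * ?m n (P (Suc i) x) \<le> norm (?A v)" by simp
  qed
  then show ?case using e(1) by (intro exI[of _ "e / 2"]) auto
qed

lemma k_lyap_exp_eq_char_exp:
  assumes "i \<le> N" "x \<in> K"
  shows "k_lyap_exp F T P i x = char_exp F T P i x"
proof (rule antisym)
  let ?m = "\<lambda>n V. min_stretch (cocycle F T n x) V"
  have sphere: "SP P i x \<inter> sphere 0 1 \<noteq> {}" using P_subset_SP P_sphere assms by blast
  have nonneg: "0 \<le> ?m n (P i x)" "0 \<le> ?m n (SP P i x)" for n
    by (rule min_stretch_nonneg[OF P_sphere[OF assms]] min_stretch_nonneg[OF sphere])+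
  show "k_lyap_exp F T P i x \<le> char_exp F T P i x"
    unfolding k_lyap_exp_def char_exp_def
    by (intro growth_rate_mono always_eventually allI conjI nonneg
        min_stretch_antimono P_sphere P_subset_SP assms)
  obtain a where a: "a > 0" "\<And>n. a * ?m n (P i x) \<le> ?m n (SP P i x)"
    using SP_stretch_lower assms by blast
  have "growth_rate (\<lambda>n. a * ?m n (P i x)) \<le> k_lyap_exp F T P i x"
    unfolding k_lyap_exp_def using a nonneg by (intro growth_rate_mono always_eventually) auto
  then show "char_exp F T P i x \<le> k_lyap_exp F T P i x"
    unfolding char_exp_def using a(1) nonneg by (simp add: growth_rate_cmult)
qed

lemma char_exp_gap:
  assumes "exp_separated K F T \<gamma> (P i) (P (Suc i))" "i < N" "x \<in> K"
  shows "char_exp F T P (Suc i) x \<le> ereal (ln \<gamma>) + char_exp F T P i x"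
proof -
  let ?m = "\<lambda>n V. min_stretch (cocycle F T n x) V"
  have sphere: "P i x \<inter> sphere 0 1 \<noteq> {}" "P (Suc i) x \<inter> sphere 0 1 \<noteq> {}" using P_sphere assms by auto
  obtain M where M: "M > 0" "\<And>n. ?m n (P (Suc i) x) \<le> M * \<gamma> ^ n * ?m n (P i x)"
    using exp_separated_min_stretch[OF assms(1,3) sphere] by blast
  have "char_exp F T P (Suc i) x \<le> growth_rate (\<lambda>n. M * \<gamma> ^ n * ?m n (P i x))"
    unfolding char_exp_def
    by (intro growth_rate_mono always_eventually allI conjI M(2) min_stretch_nonneg sphere)
  also have "\<dots> = ereal (ln \<gamma>) + char_exp F T P i x"
    unfolding char_exp_def
    by (intro growth_rate_scale M(1) min_stretch_nonneg sphere) (use assms in \<open>simp add: exp_separated_def\<close>)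
  finally show ?thesis .
qed

text \<open>The first nonvanishing component is separated from every later summand and from the complement,
  so the remaining part of the vector becomes negligible relative to it.\<close>

lemma lyap_exp_Proj:
  assumes x: "x \<in> K" and i: "i \<le> N" "Proj N P Q i x v \<noteq> 0" "\<And>l. l < i \<Longrightarrow> Proj N P Q l x v = 0"
  shows "lyap_exp F T x v = lyap_exp F T x (Proj N P Q i x v)"
proof -
  obtain p q where pq: "\<And>l. l \<le> N \<Longrightarrow> p l \<in> P l x" "q \<in> Q x" "v = (\<Sum>l\<le>N. p l) + q"
    using decomposesE[OF decomposes_at[OF x], of v] by metis
  have Proj: "Proj N P Q l x v = p l" if "l \<le> N" for l
    by (rule Proj_eq[where P = P and p = p and x = x])
      (fact decomposes_at[OF x] P_subspace[OF _ x] Q_subspace[OF x] pq that)+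
  have pi: "p i \<noteq> 0" "p i \<in> P i x" using i pq Proj by auto
  have low: "p l = 0" if "l < i" for l using i that Proj[of l] by auto
  let ?A = "\<lambda>n. cocycle F T n x"
  have nz: "?A n (p i) \<noteq> 0" for n
    by (rule cocycle_nonzero[OF P_invariant[OF i(1)] P_injective[OF i(1)] x pi(2,1)])
  have v: "v = p i + ((\<Sum>l\<in>{i<..N}. p l) + q)"
  proof -
    have "(\<Sum>l\<le>N. p l) = (\<Sum>l\<in>{i..N}. p l)"
      by (rule sum.mono_neutral_right) (auto simp: low)
    also have "{i..N} = insert i {i<..N}" using i by auto
    finally show ?thesis using pq(3) by (simp add: add.assoc)
  qed
  define b where "b n = ?A n ((\<Sum>l\<in>{i<..N}. p l) + q)" for n
  have "norm (norm (b n) / norm (?A n (p i))) \<le>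
      (\<Sum>l\<in>{i<..N}. norm (?A n (p l)) / norm (?A n (p i))) + norm (?A n q) / norm (?A n (p i))" for n
  proof -
    have "norm (b n) \<le> (\<Sum>l\<in>{i<..N}. norm (?A n (p l))) + norm (?A n q)"
      unfolding b_def blinfun.add_right blinfun.sum_right
      by (intro norm_triangle_le add_right_mono norm_sum)
    then have "norm (b n) / norm (?A n (p i)) \<le>
        ((\<Sum>l\<in>{i<..N}. norm (?A n (p l))) + norm (?A n q)) / norm (?A n (p i))"
      by (intro divide_right_mono) auto
    then show ?thesis by (simp add: add_divide_distrib sum_divide_distrib)
  qed
  note le = this
  have "(\<lambda>n. norm (?A n (p l)) / norm (?A n (p i))) \<longlonglongrightarrow> 0" if l: "l \<in> {i<..N}" for l
  proof -
    obtain \<gamma> where \<gamma>: "exp_separated K F T \<gamma> (P i) (P l)" using separated[of i l] l by auto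
    show ?thesis
      by (rule exp_separated_quotient_tendsto_0[OF \<gamma> x pi(2,1) _ nz]) (use l pq in auto)
  qed
  then have 1: "(\<lambda>n. \<Sum>l\<in>{i<..N}. norm (?A n (p l)) / norm (?A n (p i))) \<longlonglongrightarrow> 0"
    by (rule tendsto_null_sum)
  obtain \<gamma> where \<gamma>: "exp_separated K F T \<gamma> (P i) Q" using separated_Q i by blast
  have 2: "(\<lambda>n. norm (?A n q) / norm (?A n (p i))) \<longlonglongrightarrow> 0"
    by (rule exp_separated_quotient_tendsto_0[OF \<gamma> x pi(2,1) pq(2) nz])
  have "(\<lambda>n. norm (b n) / norm (?A n (p i))) \<longlonglongrightarrow> 0"
    by (rule Lim_null_comparison[OF always_eventually[OF allI[OF le]] tendsto_add_zero[OF 1 2]])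
  from growth_rate_perturb[OF nz this] show ?thesis
    unfolding lyap_exp_def Proj[OF i(1)] by (simp add: b_def v blinfun.add_right)
qed

end

theorem corollaryB:
  fixes K :: "'a::banach set"
    and F :: "'a \<Rightarrow> 'a"
    and T :: "'a \<Rightarrow> 'a \<Rightarrow>\<^sub>L 'a"
    and N :: nat
    and k :: "nat \<Rightarrow> nat"
    and C :: "nat \<Rightarrow> 'a set"
    and P :: "nat \<Rightarrow> 'a \<Rightarrow> 'a set"
    and Q :: "'a \<Rightarrow> 'a set"
  assumes "K \<noteq> {}" and "compact K"
    and "\<exists>F'. homeomorphism K K F F'"
    and "continuous_on K T"
    and "\<forall>x\<in>K. compact_operator (T x)"
    and "N \<ge> 1"
    and "0 < k 0" and "\<forall>i<N. k i < k (Suc i)"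
    and "\<forall>i\<le>N. k_solid (k i) (C i) \<and> k_complemented (k i) (C i)"
    and "\<forall>x\<in>K. \<forall>i\<le>N. blinfun_apply (T x) ` (C i - {0}) \<subseteq> interior (C i)"
    and "\<forall>i\<le>N. dim_bundle K (j_of k i) (P i)"
    and "codim_bundle K (k N) Q"
    and "invariant_decomposition K F T N P Q"
    and "\<forall>x\<in>K. P 0 x - {0} \<subseteq> interior (C 0)"
    and "\<forall>x\<in>K. \<forall>i<N. P (Suc i) x - {0} \<subseteq> interior (C (Suc i)) - C i"
    and "\<forall>x\<in>K. Q x - {0} \<subseteq> - C N"
  shows
    "(\<exists>\<gamma> :: nat \<Rightarrow> real.
        (\<forall>i<N. 0 < \<gamma> i \<and> \<gamma> i < 1) \<and>
        (\<forall>x\<in>K. \<forall>i<N. char_exp F T P i x + ereal (ln (\<gamma> i)) \<ge> char_exp F T P (Suc i) x) \<and>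
        (\<forall>x\<in>K. char_exp F T P N x \<ge> k_lyap_exp F T P N x) \<and>
        (\<forall>x\<in>K. \<forall>i<N. char_exp F T P i x \<ge> k_lyap_exp F T P i x \<and>
           k_lyap_exp F T P i x \<ge> char_exp F T P (Suc i) x - ereal (ln (\<gamma> i)))) \<and>
     (\<forall>x\<in>K. \<forall>v. v \<notin> Q x \<longrightarrow>
        (\<forall>i\<le>N. Proj N P Q i x v \<noteq> 0 \<and> (\<forall>l<i. Proj N P Q l x v = 0) \<longrightarrow>
           lyap_exp F T x v = lyap_exp F T x (Proj N P Q i x v)))"
proof -
  have cone: "closed (C i)" "0 \<in> C i" "\<And>r v. v \<in> C i \<Longrightarrow> r *\<^sub>R v \<in> C i" if "i \<le> N" for i
  proof -
    have kc: "k_cone (k i) (C i)" using assms(9) that by (simp add: k_solid_def)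
    then show "closed (C i)" "\<And>r v. v \<in> C i \<Longrightarrow> r *\<^sub>R v \<in> C i" by (auto simp: k_cone_def)
    obtain H where "H \<in> G (k i)" "H \<subseteq> C i" using kc by (auto simp: k_cone_def)
    then show "0 \<in> C i" using subspace_0[of H] by (auto simp: G_def finite_dim_def)
  qed
  interpret cone_decomposition K F T N "j_of k" "k N" C P Q
  proof unfold_locales
    show "\<And>x. x \<in> K \<Longrightarrow> F x \<in> K" "continuous_on K F"
      using assms(3) by (auto simp: homeomorphism_def)
    show "j_of k i > 0" if "i \<le> N" for i
      using assms(7,8) that by (cases i) (auto simp: j_of_def)
    show "k N > 0"
    proof (cases N)
      case (Suc m)
      then show ?thesis using assms(8)[rule_format, of m] by simp
    qed (use assms(7) in simp)
    show "v \<in> interior (C i)" if "i \<le> N" "x \<in> K" "v \<in> P i x" "v \<noteq> 0" for i x v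
    proof (cases i)
      case 0
      then show ?thesis using assms(14) that by blast
    next
      case (Suc m)
      then have "P (Suc m) x - {0} \<subseteq> interior (C (Suc m)) - C m" using assms(15) that by auto
      then show ?thesis using Suc that by blast
    qed
    show "T x v \<in> interior (C i)" if "i \<le> N" "x \<in> K" "v \<in> C i" "v \<noteq> 0" for i x v
    proof -
      have "T x ` (C i - {0}) \<subseteq> interior (C i)" using assms(10) that by blast
      then show ?thesis using that by blast
    qed
    show "v = 0" if "i < N" "x \<in> K" "v \<in> P (Suc i) x" "v \<in> C i" for i x v
    proof -
      have "P (Suc i) x - {0} \<subseteq> interior (C (Suc i)) - C i" using assms(15) that by blast
      then show ?thesis using that by blast
    qed
    show "v = 0" if "x \<in> K" "v \<in> Q x" "v \<in> C N" for x v
      using assms(16) that by blast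
  qed (use assms(2,4,5,11-13) cone in simp_all)
  have "\<forall>i<N. \<exists>\<gamma>. exp_separated K F T \<gamma> (P i) (P (Suc i))" using consecutive_separated by blast
  then obtain \<gamma> where \<gamma>: "\<And>i. i < N \<Longrightarrow> exp_separated K F T (\<gamma> i) (P i) (P (Suc i))" by metis
  have gap: "char_exp F T P (Suc i) x \<le> char_exp F T P i x + ereal (ln (\<gamma> i))" if "i < N" "x \<in> K" for i x
    using char_exp_gap[OF \<gamma>] that by (simp add: add.commute)
  have gap': "char_exp F T P (Suc i) x - ereal (ln (\<gamma> i)) \<le> char_exp F T P i x" if "i < N" "x \<in> K" for i x
    using gap[OF that] by (simp add: ereal_minus_le)
  show ?thesis
    using \<gamma> gap gap' k_lyap_exp_eq_char_exp lyap_exp_Proj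
    by (intro conjI exI[of _ \<gamma>]) (auto simp: exp_separated_def)
qed

end
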